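(* There exist absolute constants $c>0$ and $n_0\in\mathbb{N}$ such that for every $n\geq n_0$ and all isotropic log-concave probability measures $\mu,\nu$ on $\mathbb{R}^n$, $$\mathbb{E}_{\nu}(\varphi_{\mu}):=\int_{\mathbb{R}^n}\varphi_{\mu}(x)\,d\nu(x)\leq \exp\left(-cn/L_{\nu}^2\right).$$
   Context: A log-concave probability measure on $\mathbb{R}^n$ is a Borel probability measure $\mu$ such that $\mu(\lambda A+(1-\lambda)B)\geq \mu(A)^{\lambda}\mu(B)^{1-\lambda}$ for all compact $A,B\subseteq\mathbb{R}^n$ and $\lambda\in(0,1)$, and $\mu(H)<1$ for every hyperplane $H$; it has a log-concave density $f_\mu$. It is isotropic if its barycenter is $0$ and its covariance matrix is the identity. Tukey's half-space depth is $\varphi_\mu(x)=\inf\{\mu(H): H$ a half-space of $\mathbb{R}^n$ containing $x\}$. For isotropic $\nu$, the isotropic constant is $L_\nu=\|f_\nu\|_\infty^{1/n}$ (in general $L_\nu=(\sup f_\nu)^{1/n}[\det\mathrm{Cov}(\nu)]^{1/(2n)}$). *)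

theory Defs
  imports "HOL-Probability.Probability"
begin

text \<open>R^n is modelled as the extensional functions {..<n} -> real (coordinates i < n),
  with the product topology inherited from nat => real and the product Borel
  sigma-algebra; Lebesgue measure is the product of lborel.\<close>

definition Rn :: "nat \<Rightarrow> (nat \<Rightarrow> real) set" where
  "Rn n = PiE {..<n} (\<lambda>_. UNIV)"

definition lebesgue_n :: "nat \<Rightarrow> (nat \<Rightarrow> real) measure" where
  "lebesgue_n n = PiM {..<n} (\<lambda>_. lborel)"

definition mink_comb :: "nat \<Rightarrow> real \<Rightarrow> (nat \<Rightarrow> real) set \<Rightarrow> (nat \<Rightarrow> real) set \<Rightarrow> (nat \<Rightarrow> real) set" where
  "mink_comb n t A B = {restrict (\<lambda>i. t * x i + (1 - t) * y i) {..<n} | x y. x \<in> A \<and> y \<in> B}"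

definition hyperplane_n :: "nat \<Rightarrow> (nat \<Rightarrow> real) set \<Rightarrow> bool" where
  "hyperplane_n n H \<longleftrightarrow> (\<exists>a b. (\<exists>i<n. a i \<noteq> 0) \<and> H = {x \<in> Rn n. (\<Sum>i<n. a i * x i) = b})"

definition halfspace_n :: "nat \<Rightarrow> (nat \<Rightarrow> real) set \<Rightarrow> bool" where
  "halfspace_n n H \<longleftrightarrow> (\<exists>a b. (\<exists>i<n. a i \<noteq> 0) \<and> H = {x \<in> Rn n. (\<Sum>i<n. a i * x i) \<ge> b})"

definition log_concave_prob :: "nat \<Rightarrow> (nat \<Rightarrow> real) measure \<Rightarrow> bool" where
  "log_concave_prob n \<mu> \<longleftrightarrow>
     prob_space \<mu> \<and> sets \<mu> = sets (lebesgue_n n) \<and>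
     (\<forall>A B t. A \<subseteq> Rn n \<and> B \<subseteq> Rn n \<and> compact A \<and> compact B \<and> 0 < t \<and> t < 1 \<longrightarrow>
        measure \<mu> (mink_comb n t A B) \<ge> measure \<mu> A powr t * measure \<mu> B powr (1 - t)) \<and>
     (\<forall>H. hyperplane_n n H \<longrightarrow> measure \<mu> H < 1)"

definition isotropic :: "nat \<Rightarrow> (nat \<Rightarrow> real) measure \<Rightarrow> bool" where
  "isotropic n \<mu> \<longleftrightarrow>
     (\<forall>i<n. integrable \<mu> (\<lambda>x. x i) \<and> (\<integral>x. x i \<partial>\<mu>) = 0) \<and>
     (\<forall>i<n. \<forall>j<n. integrable \<mu> (\<lambda>x. x i * x j) \<and>
        (\<integral>x. x i * x j \<partial>\<mu>) = (if i = j then 1 else 0))"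

definition tukey_depth :: "nat \<Rightarrow> (nat \<Rightarrow> real) measure \<Rightarrow> (nat \<Rightarrow> real) \<Rightarrow> real" where
  "tukey_depth n \<mu> x = Inf {measure \<mu> H | H. halfspace_n n H \<and> x \<in> H}"

text \<open>Isotropic constant of an isotropic measure: (sup of density)^(1/n), the sup being the
  essential supremum of the density (Radon-Nikodym derivative w.r.t. Lebesgue measure).\<close>
definition isotropic_constant :: "nat \<Rightarrow> (nat \<Rightarrow> real) measure \<Rightarrow> real" where
  "isotropic_constant n \<nu> =
     enn2real (esssup (lebesgue_n n) (RN_deriv (lebesgue_n n) \<nu>)) powr (1 / real n)"

end

theory Submission
  imports Defs
begin

text \<open>If \<open>Y\<close> is the mean of \<open>s\<close> independent copies of \<open>\<mu>\<close>, every half-space \<open>H\<close> has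
  \<open>\<mu>(H)\<^sup>s \<le> P(Y \<in> H)\<close>, so the depth of \<open>\<mu>\<close> to the power \<open>s\<close> is at most the depth of \<open>Y\<close>. Let \<open>h\<close> be
  the convolution of the law of \<open>Y\<close> with the Gaussian \<open>exp (- s |x|\<^sup>2 / 2)\<close>, whose integral is
  \<open>V = (2 \<pi> / s)\<^bsup>n/2\<^esup>\<close>; it is log-concave. Separating \<open>x\<close> from the convex set where \<open>h\<close> exceeds \<open>h(x)\<close>
  gives a half-space through \<open>x\<close> on which \<open>h \<le> h(x)\<close>, hence
  \<open>\<phi>(x)\<^sup>s \<le> (2 / V) h(x)\<^bsup>1/2\<^esup> \<integral> h\<^bsup>1/2\<^esup>\<close>. Log-concavity between \<open>x\<close> and \<open>0\<close>, together with
  \<open>h(0) \<ge> exp (- n / 2)\<close> by Jensen, bounds \<open>\<integral> h\<^bsup>1/2\<^esup>\<close> by \<open>2\<^sup>n exp (n / 4) V\<close>, so \<open>\<integral> \<phi>\<^sup>s \<le> (C / s)\<^bsup>n/2\<^esup>\<close>.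
  With the density of \<open>\<nu>\<close> at most \<open>L\<^sup>n\<close>, the \<open>s\<close>-th moment of \<open>\<phi>\<close> under \<open>\<nu>\<close> is at most \<open>exp (- n)\<close>
  for \<open>s\<close> of order \<open>L\<^sup>2\<close>, and the theorem follows by convexity of the \<open>s\<close>-th power.\<close>

section \<open>Lebesgue measure and Gaussian integrals\<close>

text \<open>Points of \<open>Rn n\<close> are \<open>undefined\<close> from coordinate
  \<open>n\<close> on, so sums and multiples of them may leave \<open>Rn n\<close>. Functions are
  therefore taken on all of \<open>nat \<Rightarrow> real\<close>, and this predicate makes the junk
  coordinates harmless.\<close>

definition local_fun :: "nat \<Rightarrow> ((nat \<Rightarrow> real) \<Rightarrow> 'b) \<Rightarrow> bool" where
  "local_fun n u \<longleftrightarrow> (\<forall>x y. (\<forall>i<n. x i = y i) \<longrightarrow> u x = u y)"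

lemma space_lebesgue_n: "space (lebesgue_n n) = Rn n"
  by (simp add: lebesgue_n_def Rn_def space_PiM)

lemma sigma_finite_lebesgue_n: "sigma_finite_measure (lebesgue_n n)"
proof -
  interpret product_sigma_finite "\<lambda>_::nat. lborel :: real measure" by standard
  show ?thesis unfolding lebesgue_n_def by (rule sigma_finite) simp
qed

lemma measurable_coord:
  assumes "sets M = sets (lebesgue_n n)"
  shows "(\<lambda>x. x i) \<in> borel_measurable M"
proof (cases "i < n")
  case True
  then have "(\<lambda>x. x i) \<in> borel_measurable (lebesgue_n n)"
    unfolding lebesgue_n_def using measurable_component_singleton[of i "{..<n}" "\<lambda>_. lborel :: real measure"] by simp
  then show ?thesis using assms by (simp cong: measurable_cong_sets)
next
  case False
  have "space M = Rn n" using sets_eq_imp_space_eq[OF assms] by (simp add: space_lebesgue_n)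
  then have "x i = undefined" if "x \<in> space M" for x
    using that False by (auto simp: Rn_def PiE_def extensional_def)
  then show ?thesis by (subst measurable_cong[where g="\<lambda>_. undefined"]) auto
qed

text \<open>Open sets of the full product space trace measurable sets on \<open>Rn n\<close>.
  Continuity on the whole space thus gives measurability for measures on
  \<open>Rn n\<close>.\<close>

lemma measurable_id_borel:
  assumes "sets M = sets (lebesgue_n n)"
  shows "(\<lambda>x. x) \<in> measurable M borel"
  by (rule measurable_coordinatewise_then_product) (rule measurable_coord[OF assms])

lemma continuous_on_affine_coords: "continuous_on UNIV (\<lambda>x. \<lambda>i. d i + c * x i :: real)"
  by (intro continuous_on_coordinatewise_then_product continuous_intros
      continuous_on_product_coordinates)

lemma measurable_affine_coords: "(\<lambda>x. \<lambda>i. d i + c * x i :: real) \<in> measurable borel (borel :: (nat \<Rightarrow> real) measure)"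
  by (intro borel_measurable_continuous_onI continuous_on_affine_coords)

text \<open>On boxes the claim factors into the one-dimensional scaling rule for
  \<open>lborel\<close>, and the values on boxes determine the product measure.\<close>

lemma PiM_lborel_affine:
  fixes c :: real and d :: "'i \<Rightarrow> real"
  assumes I: "finite I" and c: "c \<noteq> 0"
  defines "L \<equiv> PiM I (\<lambda>_. lborel)"
  shows "L = scale_measure (ennreal (\<bar>c\<bar> ^ card I)) (distr L L (\<lambda>x. \<lambda>i\<in>I. d i + c * x i))"
proof -
  interpret product_sigma_finite "\<lambda>_::'i. lborel :: real measure" by standard
  have T[measurable]: "(\<lambda>x. \<lambda>i\<in>I. d i + c * x i) \<in> measurable L L"
    unfolding L_def by measurable
  have one: "ennreal \<bar>c\<bar> * emeasure lborel {x. e + c * x \<in> A} = emeasure lborel A"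
    if A[measurable]: "A \<in> sets lborel" for A :: "real set" and e
  proof -
    have "emeasure lborel A = emeasure (density (distr lborel borel (\<lambda>x. e + c * x)) (\<lambda>_. ennreal \<bar>c\<bar>)) A"
      by (subst lborel_real_affine[OF c, of e]) simp
    also have "\<dots> = ennreal \<bar>c\<bar> * emeasure (distr lborel borel (\<lambda>x. e + c * x)) A"
      using A by (subst emeasure_density) (auto simp: nn_integral_cmult_indicator)
    also have "emeasure (distr lborel borel (\<lambda>x. e + c * x)) A = emeasure lborel {x. e + c * x \<in> A}"
      using A by (subst emeasure_distr) (auto simp: vimage_def)
    finally show ?thesis by simp
  qed
  show ?thesis unfolding L_def
  proof (rule PiM_eqI[OF I, symmetric])
    show "sets (scale_measure (ennreal (\<bar>c\<bar> ^ card I)) (distr (PiM I (\<lambda>_. lborel)) (PiM I (\<lambda>_. lborel)) (\<lambda>x. \<lambda>i\<in>I. d i + c * x i))) = sets (PiM I (\<lambda>_. lborel))"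
      by simp
    fix A :: "'i \<Rightarrow> real set" assume A: "\<And>i. i \<in> I \<Longrightarrow> A i \<in> sets lborel"
    have m: "{x. d i + c * x \<in> A i} \<in> sets lborel" if "i \<in> I" for i
    proof -
      have "(\<lambda>x. d i + c * x) -` A i \<inter> space borel \<in> sets borel"
        using A[OF that] by (intro measurable_sets[of _ borel borel]) auto
      then show ?thesis by (simp add: vimage_def)
    qed
    have pre: "(\<lambda>x. \<lambda>i\<in>I. d i + c * x i) -` (Pi\<^sub>E I A) \<inter> space (PiM I (\<lambda>_. lborel)) = Pi\<^sub>E I (\<lambda>i. {x. d i + c * x \<in> A i})"
      by (auto simp: space_PiM PiE_def Pi_def)
    have "emeasure (distr (PiM I (\<lambda>_. lborel)) (PiM I (\<lambda>_. lborel)) (\<lambda>x. \<lambda>i\<in>I. d i + c * x i)) (Pi\<^sub>E I A)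
       = (\<Prod>i\<in>I. emeasure lborel {x. d i + c * x \<in> A i})"
      using A I m T by (subst emeasure_distr) (auto simp: pre emeasure_PiM L_def)
    then have "emeasure (scale_measure (ennreal (\<bar>c\<bar> ^ card I)) (distr (PiM I (\<lambda>_. lborel)) (PiM I (\<lambda>_. lborel)) (\<lambda>x. \<lambda>i\<in>I. d i + c * x i))) (Pi\<^sub>E I A)
        = (\<Prod>i\<in>I. ennreal \<bar>c\<bar> * emeasure lborel {x. d i + c * x \<in> A i})"
      by (simp add: prod.distrib ennreal_power[symmetric])
    also have "\<dots> = (\<Prod>i\<in>I. emeasure lborel (A i))"
      by (intro prod.cong refl one A)
    finally show "emeasure (scale_measure (ennreal (\<bar>c\<bar> ^ card I)) (distr (PiM I (\<lambda>_. lborel)) (PiM I (\<lambda>_. lborel)) (\<lambda>x. \<lambda>i\<in>I. d i + c * x i))) (Pi\<^sub>E I A)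
        = (\<Prod>i\<in>I. emeasure lborel (A i))" .
  qed
qed

text \<open>The substitution formula with the restriction to \<open>{..<n}\<close> dropped;
  \<open>local_fun\<close> makes the two versions agree.\<close>

lemma nn_integral_lebesgue_n_affine:
  fixes u :: "(nat \<Rightarrow> real) \<Rightarrow> ennreal"
  assumes u: "u \<in> borel_measurable borel" and loc: "local_fun n u" and c: "c \<noteq> 0"
  shows "(\<integral>\<^sup>+x. u x \<partial>lebesgue_n n) = ennreal (\<bar>c\<bar> ^ n) * (\<integral>\<^sup>+x. u (\<lambda>i. d i + c * x i) \<partial>lebesgue_n n)"
proof -
  let ?L = "lebesgue_n n" and ?T = "\<lambda>x. \<lambda>i\<in>{..<n}. d i + c * x i"
  have [measurable]: "u \<in> borel_measurable ?L"
    using measurable_comp[OF measurable_id_borel u, of ?L n] by (simp add: o_def)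
  have [measurable]: "?T \<in> measurable ?L ?L"
    unfolding lebesgue_n_def by measurable
  have "(\<integral>\<^sup>+x. u x \<partial>?L) = (\<integral>\<^sup>+x. u x \<partial>scale_measure (ennreal (\<bar>c\<bar> ^ n)) (distr ?L ?L ?T))"
    using PiM_lborel_affine[of "{..<n}" c d, OF _ c] by (simp add: lebesgue_n_def)
  also have "\<dots> = ennreal (\<bar>c\<bar> ^ n) * (\<integral>\<^sup>+x. u (?T x) \<partial>?L)"
    by (subst nn_integral_scale_measure) (auto simp: nn_integral_distr)
  also have "(\<lambda>x. u (?T x)) = (\<lambda>x. u (\<lambda>i. d i + c * x i))"
    by (intro ext loc[unfolded local_fun_def, rule_format]) simp
  finally show ?thesis .
qed

lemma nn_integral_gaussian_real:
  fixes s :: real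
  assumes s: "0 < s"
  shows "(\<integral>\<^sup>+x. ennreal (exp (- (s/2 * x\<^sup>2))) \<partial>lborel) = ennreal (sqrt (2 * pi / s))"
proof -
  let ?\<sigma> = "1 / sqrt s"
  have sg: "?\<sigma> > 0" using s by simp
  have eq: "exp (- (s/2 * x\<^sup>2)) = sqrt (2 * pi / s) * normal_density 0 ?\<sigma> x" for x
    using s by (simp add: normal_density_def field_simps real_sqrt_mult real_sqrt_divide power2_eq_square)
  have "(\<integral>\<^sup>+x. ennreal (normal_density 0 ?\<sigma> x) \<partial>lborel) = 1"
    using sg by (subst nn_integral_eq_integral) auto
  then show ?thesis
    unfolding eq using s by (subst ennreal_mult') (auto simp: nn_integral_cmult)
qed

lemma nn_integral_gaussian:
  fixes s :: real
  assumes s: "0 < s"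
  shows "(\<integral>\<^sup>+x. ennreal (exp (- (s/2 * (\<Sum>i<n. (x i)\<^sup>2)))) \<partial>lebesgue_n n) = ennreal (sqrt (2 * pi / s) ^ n)"
proof -
  interpret product_sigma_finite "\<lambda>_::nat. lborel :: real measure" by standard
  have "ennreal (exp (- (s/2 * (\<Sum>i<n. (x i)\<^sup>2)))) = (\<Prod>i<n. ennreal (exp (- (s/2 * (x i)\<^sup>2))))" for x :: "nat \<Rightarrow> real"
    by (subst prod_ennreal) (auto simp: exp_sum[symmetric] sum_negf sum_distrib_left)
  then show ?thesis
    unfolding lebesgue_n_def
    using s by (simp only:, subst product_nn_integral_prod)
      (auto simp only: nn_integral_gaussian_real prod_constant card_lessThan finite_lessThan
         ennreal_power[symmetric] real_sqrt_ge_zero intro!: borel_measurable_continuous_onI continuous_intros, auto simp: ennreal_power)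
qed

section \<open>The Prekopa-Leindler inequality on the line\<close>

text \<open>Tonelli on the region \<open>0 < l < F x\<close> under the graph; negative values of
  \<open>F\<close> contribute nothing on either side.\<close>

lemma nn_integral_layer_cake:
  fixes F :: "real \<Rightarrow> real"
  assumes F[measurable]: "F \<in> borel_measurable borel"
  shows "(\<integral>\<^sup>+x. ennreal (F x) \<partial>lborel) = (\<integral>\<^sup>+l. indicator {0<..} l * emeasure lborel {x. l < F x} \<partial>lborel)"
proof -
  have "(\<integral>\<^sup>+x. ennreal (F x) \<partial>lborel) = (\<integral>\<^sup>+x. (\<integral>\<^sup>+l. indicator {0<..<F x} l \<partial>lborel) \<partial>lborel)"
  proof (intro nn_integral_cong)
    show "ennreal (F x) = (\<integral>\<^sup>+l. indicator {0<..<F x} l \<partial>lborel)" for x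
      by (cases "0 \<le> F x") (auto simp: ennreal_neg)
  qed
  also have "\<dots> = (\<integral>\<^sup>+x. (\<integral>\<^sup>+l. (if 0 < l \<and> l < F x then 1 else 0) \<partial>lborel) \<partial>lborel)"
    by (intro nn_integral_cong) (auto simp: indicator_def)
  also have "\<dots> = (\<integral>\<^sup>+l. (\<integral>\<^sup>+x. (if 0 < l \<and> l < F x then 1 else 0) \<partial>lborel) \<partial>lborel)"
    by (rule lborel_pair.Fubini') measurable
  also have "\<dots> = (\<integral>\<^sup>+l. indicator {0<..} l * emeasure lborel {x. l < F x} \<partial>lborel)"
  proof (intro nn_integral_cong)
    fix l :: real
    have "(\<integral>\<^sup>+x. (if 0 < l \<and> l < F x then 1 else 0) \<partial>lborel) = (\<integral>\<^sup>+x. indicator {0<..} l * indicator {x. l < F x} x \<partial>lborel)"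
      by (intro nn_integral_cong) (auto simp: indicator_def)
    also have "\<dots> = indicator {0<..} l * emeasure lborel {x. l < F x}"
      by (subst nn_integral_cmult_indicator) (auto simp: pred_def[symmetric])
    finally show "(\<integral>\<^sup>+x. (if 0 < l \<and> l < F x then 1 else 0) \<partial>lborel) = indicator {0<..} l * emeasure lborel {x. l < F x}" .
  qed
  finally show ?thesis .
qed

text \<open>Convexity of \<^term>\<open>C\<close> lets lengths be compared through suprema and infima alone, with no inner regularity.\<close>

lemma brunn_minkowski_real:
  fixes A B C :: "real set"
  assumes t: "0 < t" "t < 1" and A: "A \<noteq> {}" "bounded A" and B: "B \<noteq> {}" "bounded B"
    and C: "convex C" "bounded C" "C \<in> sets lborel"
    and sub: "\<And>a b. a \<in> A \<Longrightarrow> b \<in> B \<Longrightarrow> t * a + (1 - t) * b \<in> C"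
  shows "ennreal t * emeasure lborel A + ennreal (1 - t) * emeasure lborel B \<le> emeasure lborel C"
proof -
  have C0: "C \<noteq> {}" using A B sub by auto
  note bd = bounded_imp_bdd_above bounded_imp_bdd_below
  have outer: "emeasure lborel S \<le> ennreal (Sup S - Inf S)" "Inf S \<le> Sup S"
    if "S \<noteq> {}" "bounded S" for S :: "real set"
  proof -
    have "S \<subseteq> {Inf S..Sup S}" using that by (auto intro!: cInf_lower cSup_upper bd)
    then have "emeasure lborel S \<le> emeasure lborel {Inf S..Sup S}" by (intro emeasure_mono) auto
    moreover show "Inf S \<le> Sup S" using that by (intro cInf_le_cSup bd)
    ultimately show "emeasure lborel S \<le> ennreal (Sup S - Inf S)" by simp
  qed
  have inner: "ennreal (Sup C - Inf C) \<le> emeasure lborel C"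
  proof -
    have "{Inf C<..<Sup C} \<subseteq> C"
    proof
      fix x assume x: "x \<in> {Inf C<..<Sup C}"
      obtain p where p: "p \<in> C" "p < x" using x C0 C by (auto simp: cInf_less_iff bd)
      obtain q where q: "q \<in> C" "x < q" using x C0 C by (auto simp: less_cSup_iff bd)
      have "is_interval C" using C by (simp add: is_interval_convex_1)
      then show "x \<in> C" using p q unfolding is_interval_1 by (meson less_imp_le)
    qed
    then have "emeasure lborel {Inf C<..<Sup C} \<le> emeasure lborel C" by (intro emeasure_mono C)
    then show ?thesis using outer(2)[OF C0 C(2)] by simp
  qed
  have 1: "t * Sup A + (1 - t) * Sup B \<le> Sup C"
  proof (rule field_le_epsilon)
    fix e :: real assume e: "0 < e"
    obtain a where a: "a \<in> A" "Sup A - e < a" using A e less_cSup_iff[of A "Sup A - e"] bd(1)[of A] by auto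
    obtain b where b: "b \<in> B" "Sup B - e < b" using B e less_cSup_iff[of B "Sup B - e"] bd(1)[of B] by auto
    have "t * (Sup A - e) + (1 - t) * (Sup B - e) \<le> t * a + (1 - t) * b"
      using a b t by (intro add_mono mult_left_mono) auto
    also have "\<dots> \<le> Sup C" by (intro cSup_upper sub a b bd C)
    finally show "t * Sup A + (1 - t) * Sup B \<le> Sup C + e" by (simp add: algebra_simps)
  qed
  have 2: "Inf C \<le> t * Inf A + (1 - t) * Inf B"
  proof (rule field_le_epsilon)
    fix e :: real assume e: "0 < e"
    obtain a where a: "a \<in> A" "a < Inf A + e" using A e cInf_less_iff[of A "Inf A + e"] bd(2)[of A] by auto
    obtain b where b: "b \<in> B" "b < Inf B + e" using B e cInf_less_iff[of B "Inf B + e"] bd(2)[of B] by auto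
    have "Inf C \<le> t * a + (1 - t) * b" by (intro cInf_lower sub a b bd C)
    also have "\<dots> \<le> t * (Inf A + e) + (1 - t) * (Inf B + e)"
      using a b t by (intro add_mono mult_left_mono) auto
    finally show "Inf C \<le> t * Inf A + (1 - t) * Inf B + e" by (simp add: algebra_simps)
  qed
  have "ennreal t * emeasure lborel A + ennreal (1 - t) * emeasure lborel B
      \<le> ennreal t * ennreal (Sup A - Inf A) + ennreal (1 - t) * ennreal (Sup B - Inf B)"
    by (intro add_mono mult_left_mono outer A B) auto
  also have "\<dots> = ennreal (t * (Sup A - Inf A) + (1 - t) * (Sup B - Inf B))"
    using t outer(2)[OF A] outer(2)[OF B] by (simp add: ennreal_mult[symmetric] ennreal_plus)
  also have "\<dots> \<le> ennreal (Sup C - Inf C)"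
    using 1 2 by (intro ennreal_leI) (simp add: algebra_simps)
  finally show ?thesis using inner by (rule order_trans)
qed

text \<open>Since \<open>F\<close> and \<open>G\<close> both have supremum 1, their superlevel sets
  are nonempty at every level in \<open>(0, 1)\<close>, so \<open>brunn_minkowski_real\<close>
  applies level by level. Integrating over the levels gives the bound with an arithmetic
  mean.\<close>

lemma prekopa_leindler_normalized:
  fixes F G H :: "real \<Rightarrow> real"
  assumes t: "0 < t" "t < 1"
    and meas[measurable]: "F \<in> borel_measurable borel" "G \<in> borel_measurable borel" "H \<in> borel_measurable borel"
    and F: "\<And>x. F x \<le> 1" "\<And>l. 0 < l \<Longrightarrow> l < 1 \<Longrightarrow> \<exists>x. l < F x" "\<And>l. 0 < l \<Longrightarrow> bounded {x. l < F x}"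
    and G: "\<And>x. G x \<le> 1" "\<And>l. 0 < l \<Longrightarrow> l < 1 \<Longrightarrow> \<exists>x. l < G x" "\<And>l. 0 < l \<Longrightarrow> bounded {x. l < G x}"
    and H: "\<And>l. 0 < l \<Longrightarrow> bounded {x. l < H x}" "\<And>l. 0 < l \<Longrightarrow> convex {x. l < H x}"
    and ineq: "\<And>a b. F a powr t * G b powr (1 - t) \<le> H (t * a + (1 - t) * b)"
  shows "ennreal t * (\<integral>\<^sup>+x. F x \<partial>lborel) + ennreal (1 - t) * (\<integral>\<^sup>+x. G x \<partial>lborel) \<le> (\<integral>\<^sup>+x. H x \<partial>lborel)"
proof -
  have [measurable]: "(\<lambda>l. emeasure lborel {x. l < F x}) \<in> borel_measurable borel"
    if [measurable]: "F \<in> borel_measurable borel" for F :: "real \<Rightarrow> real"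
    by measurable
  have pt: "ennreal t * (indicator {0<..} l * emeasure lborel {x. l < F x}) + ennreal (1 - t) * (indicator {0<..} l * emeasure lborel {x. l < G x})
      \<le> indicator {0<..} l * emeasure lborel {x. l < H x}" for l :: real
  proof -
    consider "l \<le> 0" | "1 \<le> l" | "0 < l" "l < 1" by linarith
    then show ?thesis
    proof cases
      case 2
      then have "{x. l < F x} = {}" "{x. l < G x} = {}" using F(1) G(1) by (auto simp: not_less intro: order_trans)
      then show ?thesis by simp
    next
      case 3
      have "t * a + (1 - t) * b \<in> {x. l < H x}" if "a \<in> {x. l < F x}" "b \<in> {x. l < G x}" for a b
      proof -
        have "l = l powr t * l powr (1 - t)" using 3 by (simp add: powr_add[symmetric])
        also have "\<dots> < F a powr t * G b powr (1 - t)"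
          using 3 t that by (intro mult_strict_mono powr_less_mono2) auto
        finally show ?thesis using ineq[of a b] by simp
      qed
      moreover have "{x. l < H x} \<in> sets lborel" by measurable
      ultimately have "ennreal t * emeasure lborel {x. l < F x} + ennreal (1 - t) * emeasure lborel {x. l < G x} \<le> emeasure lborel {x. l < H x}"
        using 3 F G H by (intro brunn_minkowski_real t) auto
      then show ?thesis using 3 by simp
    qed auto
  qed
  have "ennreal t * (\<integral>\<^sup>+x. F x \<partial>lborel) + ennreal (1 - t) * (\<integral>\<^sup>+x. G x \<partial>lborel) =
    (\<integral>\<^sup>+l. ennreal t * (indicator {0<..} l * emeasure lborel {x. l < F x}) + ennreal (1 - t) * (indicator {0<..} l * emeasure lborel {x. l < G x}) \<partial>lborel)"
    by (simp add: nn_integral_layer_cake nn_integral_add nn_integral_cmult)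
  also have "\<dots> \<le> (\<integral>\<^sup>+l. indicator {0<..} l * emeasure lborel {x. l < H x} \<partial>lborel)"
    by (intro nn_integral_mono pt)
  also have "\<dots> = (\<integral>\<^sup>+x. H x \<partial>lborel)" by (simp add: nn_integral_layer_cake)
  finally show ?thesis .
qed

text \<open>Dividing \<open>F\<close> and \<open>G\<close> by their suprema and \<open>H\<close> by
  the matching geometric mean \<open>m\<close> reduces to the normalized case. The arithmetic mean
  obtained there dominates the geometric one, and \<open>m\<close> cancels.\<close>

lemma prekopa_leindler_real:
  fixes F G H :: "real \<Rightarrow> real"
  assumes t: "0 < t" "t < 1"
    and meas[measurable]: "F \<in> borel_measurable borel" "G \<in> borel_measurable borel" "H \<in> borel_measurable borel"
    and F: "\<And>x. 0 \<le> F x" "bdd_above (range F)" "\<And>l. 0 < l \<Longrightarrow> bounded {x. l < F x}"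
    and G: "\<And>x. 0 \<le> G x" "bdd_above (range G)" "\<And>l. 0 < l \<Longrightarrow> bounded {x. l < G x}"
    and H: "\<And>x. 0 \<le> H x" "\<And>l. 0 < l \<Longrightarrow> bounded {x. l < H x}" "\<And>l. 0 < l \<Longrightarrow> convex {x. l < H x}"
    and ineq: "\<And>a b. F a powr t * G b powr (1 - t) \<le> H (t * a + (1 - t) * b)"
    and int: "(\<integral>\<^sup>+x. F x \<partial>lborel) = ennreal v0" "(\<integral>\<^sup>+x. G x \<partial>lborel) = ennreal v1"
      "(\<integral>\<^sup>+x. H x \<partial>lborel) = ennreal v" and v: "0 < v0" "0 < v1" "0 \<le> v"
  shows "v0 powr t * v1 powr (1 - t) \<le> v"
proof -
  define \<alpha> where "\<alpha> = Sup (range F)"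
  define \<beta> where "\<beta> = Sup (range G)"
  have pos: "0 < Sup (range f)" if f: "\<And>x. 0 \<le> f x" "bdd_above (range f)" "(\<integral>\<^sup>+x. f x \<partial>lborel) = ennreal w" "0 < w"
    for f :: "real \<Rightarrow> real" and w
  proof (rule ccontr)
    assume "\<not> ?thesis"
    then have "f x \<le> 0" for x using f(2) by (meson cSUP_upper UNIV_I not_less order_trans)
    then have "f = (\<lambda>_. 0)" using f(1) by (auto intro: antisym)
    then show False using f by simp
  qed
  have a: "0 < \<alpha>" "\<And>x. F x \<le> \<alpha>" and b: "0 < \<beta>" "\<And>x. G x \<le> \<beta>"
    unfolding \<alpha>_def \<beta>_def using pos[OF F(1,2) int(1) v(1)] pos[OF G(1,2) int(2) v(2)] F(2) G(2)
    by (auto intro: cSUP_upper)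
  define m where "m = \<alpha> powr t * \<beta> powr (1 - t)"
  have m: "0 < m" using a(1) b(1) by (simp add: m_def)
  have sup: "\<exists>x. l < f x / Sup (range f)" if f: "0 < Sup (range f)" "bdd_above (range f)" "l < 1" for l and f :: "real \<Rightarrow> real"
  proof -
    have "l * Sup (range f) < Sup (range f)" using f by simp
    then obtain x where "l * Sup (range f) < f x" using f(2) by (subst (asm) less_cSup_iff) auto
    then have "l < f x / Sup (range f)" using f(1) by (simp add: pos_less_divide_eq)
    then show ?thesis ..
  qed
  have sc: "(\<integral>\<^sup>+x. ennreal (f x / r) \<partial>lborel) = ennreal (w / r)"
    if "f \<in> borel_measurable borel" "\<And>x. 0 \<le> f x" "(\<integral>\<^sup>+x. f x \<partial>lborel) = ennreal w" "0 < r" "0 \<le> w" for f :: "real \<Rightarrow> real" and w r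
  proof -
    have "ennreal (f x / r) = ennreal (1 / r) * ennreal (f x)" for x
      using that(2,4) by (subst ennreal_mult[symmetric]) auto
    then have "(\<integral>\<^sup>+x. ennreal (f x / r) \<partial>lborel) = ennreal (1 / r) * ennreal w"
      using that(1,3) by (simp add: nn_integral_cmult)
    also have "\<dots> = ennreal (w / r)"
      using that(4,5) by (subst ennreal_mult[symmetric]) auto
    finally show ?thesis .
  qed
  have lev: "{x. l < f x / r} = {x. l * r < f x}" if "0 < r" for f :: "real \<Rightarrow> real" and l r
    using that by (simp add: pos_less_divide_eq)
  have "ennreal t * (\<integral>\<^sup>+x. F x / \<alpha> \<partial>lborel) + ennreal (1 - t) * (\<integral>\<^sup>+x. G x / \<beta> \<partial>lborel) \<le> (\<integral>\<^sup>+x. H x / m \<partial>lborel)"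
  proof (rule prekopa_leindler_normalized[OF t])
    show "\<exists>x. l < F x / \<alpha>" if "0 < l" "l < 1" for l using sup[of F l] a(1) F(2) that(2) unfolding \<alpha>_def by blast
    show "\<exists>x. l < G x / \<beta>" if "0 < l" "l < 1" for l using sup[of G l] b(1) G(2) that(2) unfolding \<beta>_def by blast
    show "(F x / \<alpha>) powr t * (G y / \<beta>) powr (1 - t) \<le> H (t * x + (1 - t) * y) / m" for x y
      proof -
      have "(F x / \<alpha>) powr t * (G y / \<beta>) powr (1 - t) = (F x powr t * G y powr (1 - t)) / m"
        using a(1) b(1) F(1) G(1) by (simp add: powr_divide m_def)
      then show ?thesis using ineq[of x y] m by (simp add: divide_right_mono)
    qed
    show "bounded {x. l < F x / \<alpha>}" "bounded {x. l < G x / \<beta>}" "bounded {x. l < H x / m}" "convex {x. l < H x / m}"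
      if "0 < l" for l using that a(1) b(1) m F(3) G(3) H(2,3) by (simp_all add: lev)
    show "F x / \<alpha> \<le> 1" "G x / \<beta> \<le> 1" for x using a(1) a(2)[of x] b(1) b(2)[of x] by simp_all
  qed measurable
  then have "ennreal t * ennreal (v0 / \<alpha>) + ennreal (1 - t) * ennreal (v1 / \<beta>) \<le> ennreal (v / m)"
    using sc[OF meas(1) F(1) int(1) a(1)] sc[OF meas(2) G(1) int(2) b(1)] sc[OF meas(3) H(1) int(3) m] v by simp
  then have "ennreal (t * (v0 / \<alpha>) + (1 - t) * (v1 / \<beta>)) \<le> ennreal (v / m)"
    using a(1) b(1) v t by (subst ennreal_plus) (simp_all add: ennreal_mult[symmetric])
  then have "t * (v0 / \<alpha>) + (1 - t) * (v1 / \<beta>) \<le> v / m"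
    using m v by (subst (asm) ennreal_le_iff) auto
  then have "(v0 / \<alpha>) powr t * (v1 / \<beta>) powr (1 - t) \<le> v / m"
    using Youngs_inequality_0[of t "1 - t" "v0 / \<alpha>" "v1 / \<beta>"] a(1) b(1) v t by auto
  then have "(v0 powr t * v1 powr (1 - t)) / m \<le> v / m"
    using a(1) b(1) v by (simp add: powr_divide m_def)
  then show ?thesis using m by (simp add: divide_le_cancel)
qed

section \<open>Convolution with a log-concave measure\<close>

definition log_concave_fun :: "((nat \<Rightarrow> real) \<Rightarrow> real) \<Rightarrow> bool" where
  "log_concave_fun u \<longleftrightarrow> (\<forall>x y t. 0 < t \<longrightarrow> t < 1 \<longrightarrow>
     u x powr t * u y powr (1 - t) \<le> u (\<lambda>i. t * x i + (1 - t) * y i))"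

lemma log_concave_funD:
  "log_concave_fun u \<Longrightarrow> 0 < t \<Longrightarrow> t < 1 \<Longrightarrow>
    u x powr t * u y powr (1 - t) \<le> u (\<lambda>i. t * x i + (1 - t) * y i)"
  by (auto simp: log_concave_fun_def)

text \<open>Tychonoff: an extensional product is a full product in which each coordinate outside
  \<open>I\<close> ranges over the singleton of \<open>undefined\<close>.\<close>

lemma compact_PiE_fun:
  fixes S :: "'i \<Rightarrow> 'a::topological_space set"
  assumes "\<And>i. i \<in> I \<Longrightarrow> compact (S i)"
  shows "compact (Pi\<^sub>E I S)"
proof -
  have eq: "Pi\<^sub>E I S = Pi\<^sub>E UNIV (\<lambda>i. if i \<in> I then S i else {undefined})"
    by (auto simp: PiE_def Pi_def extensional_def split: if_splits)
  have "compactin (product_topology (\<lambda>i. euclidean) UNIV) (Pi\<^sub>E UNIV (\<lambda>i. if i \<in> I then S i else {undefined}))"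
    unfolding compactin_PiE using assms by auto
  then show ?thesis by (simp add: eq euclidean_product_topology)
qed

lemma closed_Rn: "closed (Rn n)"
proof -
  have "Rn n = (\<Inter>i\<in>{n..}. {x. x i = undefined})"
    by (auto simp: Rn_def PiE_def extensional_def)
  moreover have "closed {x::nat \<Rightarrow> real. x i = undefined}" for i
    by (intro closed_Collect_eq continuous_on_product_coordinates continuous_on_const)
  ultimately show ?thesis by (auto intro!: closed_INT)
qed

text \<open>Log-concavity is assumed on compact sets only; exhausting by the cubes
  \<open>K k\<close> and passing to the limit extends it to closed sets. A Minkowski combination of
  closed sets need not be closed, hence the measurable superset \<open>C\<close>.\<close>

lemma log_concave_prob_closed:
  assumes lc: "log_concave_prob n \<mu>" and t: "0 < t" "t < 1"
    and A: "closed A" "A \<subseteq> Rn n" and B: "closed B" "B \<subseteq> Rn n"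
    and C: "C \<in> sets \<mu>" "mink_comb n t A B \<subseteq> C"
  shows "measure \<mu> A powr t * measure \<mu> B powr (1 - t) \<le> measure \<mu> C"
proof -
  interpret prob_space \<mu> using lc by (simp add: log_concave_prob_def)
  have sets: "sets \<mu> = sets (lebesgue_n n)" using lc by (simp add: log_concave_prob_def)
  have sp: "space \<mu> = Rn n" using sets_eq_imp_space_eq[OF sets] by (simp add: space_lebesgue_n)
  have closed_sets: "S \<in> sets \<mu>" if "closed S" "S \<subseteq> Rn n" for S
    using measurable_sets[OF measurable_id_borel[OF sets], of S] that by (auto simp: sp Int_absorb2)
  define K where "K k = Pi\<^sub>E {..<n} (\<lambda>_. {- real k..real k})" for k
  have K: "compact (K k)" for k unfolding K_def by (intro compact_PiE_fun) auto
  have K_mono: "K k \<subseteq> K l" if "k \<le> l" for k l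
    using that by (auto simp: K_def PiE_def Pi_def intro: order_trans[of _ "- real k"] order_trans[of _ "real k"])
  have K_UN: "(\<Union>k. S \<inter> K k) = S" if "S \<subseteq> Rn n" for S
  proof -
    have "\<exists>k. x \<in> K k" if "x \<in> Rn n" for x
    proof -
      obtain k where "(\<Sum>i<n. \<bar>x i\<bar>) \<le> real k" using real_arch_simple by blast
      then have "\<bar>x i\<bar> \<le> real k" if "i < n" for i
        using member_le_sum[of i "{..<n}" "\<lambda>i. \<bar>x i\<bar>"] that by auto
      then show ?thesis using that by (auto simp: K_def Rn_def PiE_def Pi_def abs_le_iff intro!: exI[of _ k])
        (metis abs_le_D2 minus_le_iff)
    qed
    then show ?thesis using that by auto
  qed
  have K_closed: "closed (S \<inter> K k)" "compact (S \<inter> K k)" "S \<inter> K k \<in> sets \<mu>" if "closed S" "S \<subseteq> Rn n" for S k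
    using that K[of k] by (auto intro!: closed_sets closed_Int_compact closed_Int compact_imp_closed)
  have lim: "(\<lambda>k. measure \<mu> (S \<inter> K k)) \<longlonglongrightarrow> measure \<mu> S" if "closed S" "S \<subseteq> Rn n" for S
  proof -
    have "(\<lambda>k. measure \<mu> (S \<inter> K k)) \<longlonglongrightarrow> measure \<mu> (\<Union>k. S \<inter> K k)"
    proof (rule finite_Lim_measure_incseq)
      show "range (\<lambda>k. S \<inter> K k) \<subseteq> sets \<mu>" using K_closed(3)[OF that] by auto
      show "incseq (\<lambda>k. S \<inter> K k)" unfolding incseq_def using K_mono by blast
    qed
    then show ?thesis using K_UN that by simp
  qed
  have le: "measure \<mu> (A \<inter> K k) powr t * measure \<mu> (B \<inter> K k) powr (1 - t) \<le> measure \<mu> C" for k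
  proof -
    have "measure \<mu> (A \<inter> K k) powr t * measure \<mu> (B \<inter> K k) powr (1 - t) \<le> measure \<mu> (mink_comb n t (A \<inter> K k) (B \<inter> K k))"
    proof -
      have "A \<inter> K k \<subseteq> Rn n" "B \<inter> K k \<subseteq> Rn n" using A B by auto
      then show ?thesis
        using lc t K_closed(2)[OF A] K_closed(2)[OF B] unfolding log_concave_prob_def by metis
    qed
    also have "\<dots> \<le> measure \<mu> C"
      using C by (intro finite_measure_mono) (auto simp: mink_comb_def)
    finally show ?thesis .
  qed
  \<comment> \<open>The exponents \<open>t\<close> and \<open>1 - t\<close> are positive, so the
    powers are continuous even where a measure is 0.\<close>
  have "(\<lambda>k. measure \<mu> (A \<inter> K k) powr t * measure \<mu> (B \<inter> K k) powr (1 - t)) \<longlonglongrightarrow> measure \<mu> A powr t * measure \<mu> B powr (1 - t)"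
    using t by (intro tendsto_mult tendsto_powr2 lim A B) (auto intro: always_eventually)
  then show ?thesis by (rule LIMSEQ_le_const2) (use le in auto)
qed

text \<open>The convolution of \<open>u\<close> with the law of \<open>c * y\<close>, where
  \<open>y\<close> has law \<open>\<mu>\<close>.\<close>

definition smooth :: "(nat \<Rightarrow> real) measure \<Rightarrow> real \<Rightarrow> ((nat \<Rightarrow> real) \<Rightarrow> real) \<Rightarrow> (nat \<Rightarrow> real) \<Rightarrow> real" where
  "smooth \<mu> c u x = (\<integral>y. u (\<lambda>i. x i - c * y i) \<partial>\<mu>)"

lemma comb_in_Rn:
  assumes "x \<in> Rn n" "y \<in> Rn n"
  shows "(\<lambda>i. t * x i + (1 - t) * y i) \<in> Rn n"
  using assms by (auto simp: Rn_def PiE_def extensional_def algebra_simps)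

lemma restrict_comb:
  assumes "x \<in> Rn n" "y \<in> Rn n"
  shows "restrict (\<lambda>i. t * x i + (1 - t) * y i) {..<n} = (\<lambda>i. t * x i + (1 - t) * y i)"
  using comb_in_Rn[OF assms, of t] by (simp add: Rn_def PiE_def extensional_restrict)

lemma continuous_on_shift:
  fixes u :: "(nat \<Rightarrow> real) \<Rightarrow> real"
  assumes "continuous_on UNIV u"
  shows "continuous_on UNIV (\<lambda>y. u (\<lambda>i. x i - c * y i))"
    and "continuous_on UNIV (\<lambda>x. u (\<lambda>i. x i - c * y i))"
proof -
  have "continuous_on UNIV (u \<circ> (\<lambda>y i. x i - c * y i))"
    by (intro continuous_on_compose continuous_on_subset[OF assms] continuous_on_coordinatewise_then_product
        continuous_intros continuous_on_product_coordinates) auto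
  then show "continuous_on UNIV (\<lambda>y. u (\<lambda>i. x i - c * y i))" by (simp add: o_def)
  have "continuous_on UNIV (u \<circ> (\<lambda>x i. x i - c * y i))"
    by (intro continuous_on_compose continuous_on_subset[OF assms] continuous_on_coordinatewise_then_product
        continuous_intros continuous_on_product_coordinates) auto
  then show "continuous_on UNIV (\<lambda>x. u (\<lambda>i. x i - c * y i))" by (simp add: o_def)
qed

lemma measurable_shift:
  fixes u :: "(nat \<Rightarrow> real) \<Rightarrow> real"
  assumes sets: "sets \<mu> = sets (lebesgue_n n)" and u: "continuous_on UNIV u"
  shows "(\<lambda>y. u (\<lambda>i. x i - c * y i)) \<in> borel_measurable \<mu>"
  using measurable_comp[OF measurable_id_borel[OF sets] borel_measurable_continuous_onI[OF continuous_on_shift(1)[OF u]]]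
  by (simp add: o_def)

lemma integrable_shift:
  fixes u :: "(nat \<Rightarrow> real) \<Rightarrow> real"
  assumes "prob_space \<mu>" "sets \<mu> = sets (lebesgue_n n)" "continuous_on UNIV u"
    and "\<And>x. 0 \<le> u x" "\<And>x. u x \<le> 1"
  shows "integrable \<mu> (\<lambda>y. u (\<lambda>i. x i - c * y i))"
proof -
  interpret prob_space \<mu> by fact
  show ?thesis using assms by (intro integrable_const_bound[where B=1] measurable_shift) auto
qed

text \<open>Reflecting \<open>\<tau>\<close> to \<open>a - \<tau>\<close> turns the integrand into a
  multiple of the exponential density. With \<open>a = ln w\<close> this writes a positive number
  \<open>w\<close> as an integral over logarithmic levels.\<close>

lemma nn_integral_exp_atMost: "(\<integral>\<^sup>+\<tau>. ennreal (exp \<tau>) * indicator {..a} \<tau> \<partial>lborel) = ennreal (exp a)"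
proof -
  have "(\<integral>\<^sup>+\<tau>. ennreal (exp \<tau>) * indicator {..a} \<tau> \<partial>lborel)
      = (\<integral>\<^sup>+\<tau>. ennreal (exp (a + (-1) * \<tau>)) * indicator {..a} (a + (-1) * \<tau>) \<partial>lborel)"
    by (subst nn_integral_real_affine[where c="-1" and t=a]) auto
  also have "\<dots> = (\<integral>\<^sup>+\<tau>. ennreal (exp a) * ennreal (exponential_density 1 \<tau>) \<partial>lborel)"
    by (intro nn_integral_cong) (auto simp: indicator_def exponential_density_def exp_diff exp_minus ennreal_mult[symmetric] field_simps)
  also have "\<dots> = ennreal (exp a) * emeasure (density lborel (exponential_density 1)) UNIV"
    by (subst nn_integral_cmult) (auto simp: emeasure_density)
  also have "\<dots> = ennreal (exp a)"
    using prob_space.emeasure_space_1[OF prob_space_exponential_density[of 1]] by simp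
  finally show ?thesis .
qed

text \<open>The layer cake formula in the logarithmic level \<open>\<tau>\<close> turns the integral into that of
  \<open>\<tau> \<mapsto> exp \<tau> * \<mu> {y. exp \<tau> \<le> u (z - c y)}\<close>. Log-concavity of \<open>\<mu>\<close> on closed sets is exactly the
  hypothesis of the one-dimensional Prekopa-Leindler inequality for these functions, and its case of
  equal base points makes their superlevel sets convex.\<close>

lemma log_concave_smooth:
  assumes lc: "log_concave_prob n \<mu>" and cont: "continuous_on UNIV u"
    and u: "\<And>x. 0 < u x" "\<And>x. u x \<le> 1" and lu: "log_concave_fun u"
  shows "log_concave_fun (smooth \<mu> c u)"
proof -
  interpret prob_space \<mu> using lc by (simp add: log_concave_prob_def)
  have sets: "sets \<mu> = sets (lebesgue_n n)" using lc by (simp add: log_concave_prob_def)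
  have sp: "space \<mu> = Rn n" using sets_eq_imp_space_eq[OF sets] by (simp add: space_lebesgue_n)
  \<comment> \<open>On the logarithmic scale, geometric means of levels become arithmetic means of
    \<open>\<tau>\<close>, as the one-dimensional inequality requires.\<close>
  define S where "S z \<tau> = {y \<in> Rn n. exp \<tau> \<le> u (\<lambda>i. z i - c * y i)}" for z and \<tau> :: real
  have S_closed: "closed (S z \<tau>)" for z \<tau>
    unfolding S_def Collect_conj_eq using closed_Rn
    by (auto intro!: closed_Int closed_Collect_le continuous_on_shift(1)[OF cont])
  have S_sub: "S z \<tau> \<subseteq> Rn n" for z \<tau> by (auto simp: S_def)
  have S_sets[measurable]: "S z \<tau> \<in> sets \<mu>" for z \<tau>
    using measurable_sets[OF measurable_id_borel[OF sets] borel_closed[OF S_closed]] S_sub by (auto simp: sp Int_absorb2)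
  define F where "F z \<tau> = exp \<tau> * measure \<mu> (S z \<tau>)" for z \<tau>
  have F0: "0 \<le> F z \<tau>" for z \<tau> by (simp add: F_def)
  have F_le: "F z \<tau> \<le> exp \<tau>" for z \<tau> by (simp add: F_def)
  \<comment> \<open>The bound \<open>u \<le> 1\<close> empties the levels above
    \<open>\<tau> = 0\<close>, which keeps \<open>F z\<close> bounded and its superlevel sets
    bounded on the right.\<close>
  have F_pos: "F z \<tau> = 0" if "0 < \<tau>" for z \<tau>
  proof -
    have "u x < exp \<tau>" for x using that by (intro le_less_trans[OF u(2)]) simp
    then have "S z \<tau> = {}" by (auto simp: S_def not_le)
    then show ?thesis by (simp add: F_def)
  qed
  have F_ineq: "F z a powr t * F z' b powr (1 - t) \<le> F (\<lambda>i. t * z i + (1 - t) * z' i) (t * a + (1 - t) * b)"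
    if t: "0 < t" "t < 1" for z z' a b t
  proof -
    let ?z = "\<lambda>i. t * z i + (1 - t) * z' i"
    have "mink_comb n t (S z a) (S z' b) \<subseteq> S ?z (t * a + (1 - t) * b)"
    proof
      fix w assume "w \<in> mink_comb n t (S z a) (S z' b)"
      then obtain x y where xy: "x \<in> S z a" "y \<in> S z' b" and w: "w = restrict (\<lambda>i. t * x i + (1 - t) * y i) {..<n}"
        by (auto simp: mink_comb_def)
      then have w': "w = (\<lambda>i. t * x i + (1 - t) * y i)" "w \<in> Rn n"
        using restrict_comb[of x n y t] comb_in_Rn[of x n y t] subsetD[OF S_sub xy(1)] subsetD[OF S_sub xy(2)] by simp_all
      have "exp (t * a + (1 - t) * b) = exp a powr t * exp b powr (1 - t)"
        by (simp add: powr_def exp_add)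
      also have "\<dots> \<le> u (\<lambda>i. z i - c * x i) powr t * u (\<lambda>i. z' i - c * y i) powr (1 - t)"
        using xy t u(1) by (intro mult_mono powr_mono2) (auto simp: S_def)
      also have "\<dots> \<le> u (\<lambda>i. t * (z i - c * x i) + (1 - t) * (z' i - c * y i))"
        using lu t unfolding log_concave_fun_def by blast
      also have "(\<lambda>i. t * (z i - c * x i) + (1 - t) * (z' i - c * y i)) = (\<lambda>i. ?z i - c * w i)"
        by (simp add: w'(1) algebra_simps)
      finally show "w \<in> S ?z (t * a + (1 - t) * b)" using w'(2) by (simp add: S_def)
    qed
    then have "measure \<mu> (S z a) powr t * measure \<mu> (S z' b) powr (1 - t) \<le> measure \<mu> (S ?z (t * a + (1 - t) * b))"
      by (intro log_concave_prob_closed[OF lc t] S_closed S_sub S_sets)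
    then have "exp (t * a + (1 - t) * b) * (measure \<mu> (S z a) powr t * measure \<mu> (S z' b) powr (1 - t)) \<le> F ?z (t * a + (1 - t) * b)"
      by (simp add: F_def)
    also have "exp (t * a + (1 - t) * b) * (measure \<mu> (S z a) powr t * measure \<mu> (S z' b) powr (1 - t)) = F z a powr t * F z' b powr (1 - t)"
      by (simp add: F_def powr_mult exp_add) (simp add: powr_def)
    finally show ?thesis .
  qed
  have F_meas: "F z \<in> borel_measurable borel" for z
  proof -
    have "mono (\<lambda>\<tau>. - measure \<mu> (S z \<tau>))"
    proof (rule monoI)
      fix \<tau> \<tau>' :: real assume "\<tau> \<le> \<tau>'"
      then have "exp \<tau> \<le> exp \<tau>'" by simp
      then have "S z \<tau>' \<subseteq> S z \<tau>" unfolding S_def by (blast intro: order_trans)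
      then show "- measure \<mu> (S z \<tau>) \<le> - measure \<mu> (S z \<tau>')" by (simp add: finite_measure_mono)
    qed
    from borel_measurable_mono[OF this]
    have "(\<lambda>\<tau>. exp \<tau> * - (- measure \<mu> (S z \<tau>))) \<in> borel_measurable borel"
      by measurable
    then show ?thesis by (simp add: F_def[abs_def])
  qed
  have F_bdd: "bdd_above (range (F z))" for z
  proof (rule bdd_aboveI2)
    show "F z \<tau> \<le> 1" for \<tau> using F_le[of z \<tau>] F_pos[of \<tau> z] by (cases "0 < \<tau>") (auto intro: order_trans)
  qed
  have F_bounded: "bounded {\<tau>. l < F z \<tau>}" if "0 < l" for l z
  proof (rule bounded_subset)
    show "{\<tau>. l < F z \<tau>} \<subseteq> {ln l..0}"
    proof
      fix \<tau> assume \<tau>: "\<tau> \<in> {\<tau>. l < F z \<tau>}"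
      have "l < exp \<tau>" using \<tau> F_le[of z \<tau>] by auto
      then have "ln l < \<tau>" using that by (metis ln_exp ln_less_cancel_iff exp_gt_zero)
      moreover have "\<not> 0 < \<tau>" using \<tau> F_pos[of \<tau> z] that by auto
      ultimately show "\<tau> \<in> {ln l..0}" by auto
    qed
  qed auto
  have F_convex: "convex {\<tau>. l < F z \<tau>}" if l: "0 < l" for l z
  proof (rule convexI)
    fix a b p q :: real
    assume ab: "a \<in> {\<tau>. l < F z \<tau>}" "b \<in> {\<tau>. l < F z \<tau>}" and pq: "0 \<le> p" "0 \<le> q" "p + q = 1"
    show "p *\<^sub>R a + q *\<^sub>R b \<in> {\<tau>. l < F z \<tau>}"
    proof (cases "p = 0 \<or> q = 0")
      case True then show ?thesis using ab pq by auto
    next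
      case False
      then have p: "0 < p" "p < 1" "q = 1 - p" using pq by auto
      have "l = l powr p * l powr (1 - p)" using l by (simp add: powr_add[symmetric])
      also have "\<dots> < F z a powr p * F z b powr (1 - p)"
        using l p ab by (intro mult_strict_mono powr_less_mono2) auto
      also have "\<dots> \<le> F (\<lambda>i. p * z i + (1 - p) * z i) (p * a + (1 - p) * b)" by (rule F_ineq[OF p(1,2)])
      also have "(\<lambda>i. p * z i + (1 - p) * z i) = z" by (simp add: algebra_simps)
      finally show ?thesis using p by simp
    qed
  qed
  have u_int: "integrable \<mu> (\<lambda>y. u (\<lambda>i. z i - c * y i))" for z
    by (rule integrable_shift[OF prob_space_axioms sets cont less_imp_le[OF u(1)] u(2)])
  have F_int: "(\<integral>\<^sup>+\<tau>. F z \<tau> \<partial>lborel) = ennreal (smooth \<mu> c u z)" for z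
  proof -
    have [measurable]: "(\<lambda>y. u (\<lambda>i. z i - c * y i)) \<in> borel_measurable \<mu>" by (rule measurable_shift[OF sets cont])
    have "ennreal (smooth \<mu> c u z) = (\<integral>\<^sup>+y. ennreal (u (\<lambda>i. z i - c * y i)) \<partial>\<mu>)"
      unfolding smooth_def using u(1) by (intro nn_integral_eq_integral[symmetric] u_int) (auto intro: less_imp_le)
    also have "\<dots> = (\<integral>\<^sup>+y. (\<integral>\<^sup>+\<tau>. ennreal (exp \<tau>) * (if exp \<tau> \<le> u (\<lambda>i. z i - c * y i) then 1 else 0) \<partial>lborel) \<partial>\<mu>)"
    proof (rule nn_integral_cong)
      fix y
      define w where "w = u (\<lambda>i. z i - c * y i)"
      have w: "0 < w" using u(1) by (simp add: w_def)
      have ind: "indicator {..ln w} \<tau> = (if exp \<tau> \<le> w then 1 else 0 :: ennreal)" for \<tau>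
        using w ln_ge_iff[of w \<tau>] by (simp add: indicator_def)
      have "ennreal w = ennreal (exp (ln w))" using w by simp
      also have "\<dots> = (\<integral>\<^sup>+\<tau>. ennreal (exp \<tau>) * (if exp \<tau> \<le> w then 1 else 0) \<partial>lborel)"
        using nn_integral_exp_atMost[of "ln w"] by (simp only: ind)
      finally show "ennreal (u (\<lambda>i. z i - c * y i)) = (\<integral>\<^sup>+\<tau>. ennreal (exp \<tau>) * (if exp \<tau> \<le> u (\<lambda>i. z i - c * y i) then 1 else 0) \<partial>lborel)"
        unfolding w_def .
    qed
    also have "\<dots> = (\<integral>\<^sup>+\<tau>. (\<integral>\<^sup>+y. ennreal (exp \<tau>) * (if exp \<tau> \<le> u (\<lambda>i. z i - c * y i) then 1 else 0) \<partial>\<mu>) \<partial>lborel)"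
      by (rule pair_sigma_finite.Fubini'[symmetric])
        (intro pair_sigma_finite.intro lborel.sigma_finite_measure_axioms sigma_finite_measure_axioms, measurable)
    also have "\<dots> = (\<integral>\<^sup>+\<tau>. F z \<tau> \<partial>lborel)"
    proof (rule nn_integral_cong)
      fix \<tau> :: real
      have "(\<integral>\<^sup>+y. ennreal (exp \<tau>) * (if exp \<tau> \<le> u (\<lambda>i. z i - c * y i) then 1 else 0) \<partial>\<mu>) = (\<integral>\<^sup>+y. ennreal (exp \<tau>) * indicator (S z \<tau>) y \<partial>\<mu>)"
        by (intro nn_integral_cong) (auto simp: S_def sp indicator_def)
      also have "\<dots> = ennreal (F z \<tau>)"
        by (simp add: nn_integral_cmult_indicator F_def emeasure_eq_measure ennreal_mult)
      finally show "(\<integral>\<^sup>+y. ennreal (exp \<tau>) * (if exp \<tau> \<le> u (\<lambda>i. z i - c * y i) then 1 else 0) \<partial>\<mu>) = ennreal (F z \<tau>)" .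
    qed
    finally show ?thesis by simp
  qed
  have pos: "0 < smooth \<mu> c u z" for z
    unfolding smooth_def using u_int u(1) by (intro expectation_greater) auto
  show ?thesis unfolding log_concave_fun_def
  proof (intro allI impI)
    fix x y :: "nat \<Rightarrow> real" and t :: real assume t: "0 < t" "t < 1"
    show "smooth \<mu> c u x powr t * smooth \<mu> c u y powr (1 - t) \<le> smooth \<mu> c u (\<lambda>i. t * x i + (1 - t) * y i)"
      by (rule prekopa_leindler_real[OF t F_meas F_meas F_meas F0 F_bdd F_bounded F0 F_bdd F_bounded F0 F_bounded F_convex F_ineq[OF t] F_int F_int F_int])
        (auto intro: pos less_imp_le)
  qed
qed

section \<open>Gaussians and half-space integrals\<close>

definition gauss :: "nat \<Rightarrow> real \<Rightarrow> (nat \<Rightarrow> real) \<Rightarrow> real" where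
  "gauss n s x = exp (- (s / 2 * (\<Sum>i<n. (x i)\<^sup>2)))"

lemma continuous_on_gauss: "continuous_on UNIV (gauss n s)"
  unfolding gauss_def[abs_def] by (intro continuous_intros continuous_on_product_coordinates)

lemma gauss_pos: "0 < gauss n s x"
  by (simp add: gauss_def)

lemma gauss_le_1: "0 \<le> s \<Longrightarrow> gauss n s x \<le> 1"
  by (simp add: gauss_def sum_nonneg)

lemma local_gauss: "local_fun n (gauss n s)"
  by (auto simp: local_fun_def gauss_def)

lemma log_concave_gauss:
  assumes s: "0 \<le> s"
  shows "log_concave_fun (gauss n s)"
  unfolding log_concave_fun_def
proof (intro allI impI)
  fix x y :: "nat \<Rightarrow> real" and t :: real assume t: "0 < t" "t < 1"
  have "(t * x i + (1 - t) * y i)\<^sup>2 \<le> t * (x i)\<^sup>2 + (1 - t) * (y i)\<^sup>2" for i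
  proof -
    have "t * (x i)\<^sup>2 + (1 - t) * (y i)\<^sup>2 - (t * x i + (1 - t) * y i)\<^sup>2 = t * (1 - t) * (x i - y i)\<^sup>2"
      by (simp add: power2_eq_square algebra_simps)
    moreover have "0 \<le> t * (1 - t) * (x i - y i)\<^sup>2" using t by simp
    ultimately show ?thesis by linarith
  qed
  then have "(\<Sum>i<n. (t * x i + (1 - t) * y i)\<^sup>2) \<le> (\<Sum>i<n. t * (x i)\<^sup>2 + (1 - t) * (y i)\<^sup>2)"
    by (intro sum_mono)
  then have "(\<Sum>i<n. (t * x i + (1 - t) * y i)\<^sup>2) \<le> t * (\<Sum>i<n. (x i)\<^sup>2) + (1 - t) * (\<Sum>i<n. (y i)\<^sup>2)"
    by (simp add: sum.distrib sum_distrib_left)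
  then have "s / 2 * (\<Sum>i<n. (t * x i + (1 - t) * y i)\<^sup>2) \<le> s / 2 * (t * (\<Sum>i<n. (x i)\<^sup>2) + (1 - t) * (\<Sum>i<n. (y i)\<^sup>2))"
    using s by (intro mult_left_mono) auto
  then show "gauss n s x powr t * gauss n s y powr (1 - t) \<le> gauss n s (\<lambda>i. t * x i + (1 - t) * y i)"
    by (simp add: gauss_def powr_def exp_add[symmetric] algebra_simps)
qed

lemma continuous_on_smooth:
  assumes "prob_space \<mu>" "sets \<mu> = sets (lebesgue_n n)" and cont: "continuous_on UNIV u"
    and u: "\<And>x. 0 \<le> u x" "\<And>x. u x \<le> 1"
  shows "continuous_on UNIV (smooth \<mu> c u)"
proof (rule continuous_on_sequentiallyI)
  interpret prob_space \<mu> by fact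
  fix X :: "nat \<Rightarrow> nat \<Rightarrow> real" and x assume "X \<longlonglongrightarrow> x"
  then have "(\<lambda>k. u (\<lambda>i. X k i - c * y i)) \<longlonglongrightarrow> u (\<lambda>i. x i - c * y i)" for y
    using continuous_on_tendsto_compose[OF continuous_on_shift(2)[OF cont, of c y], of X x] by simp
  then show "(\<lambda>k. smooth \<mu> c u (X k)) \<longlonglongrightarrow> smooth \<mu> c u x"
    unfolding smooth_def using u
    by (intro integral_dominated_convergence[where w="\<lambda>_. 1"] measurable_shift[OF assms(2) cont]) auto
qed

lemma local_smooth:
  assumes "local_fun n u"
  shows "local_fun n (smooth \<mu> c u)"
proof -
  have "u (\<lambda>i. x i - c * z i) = u (\<lambda>i. y i - c * z i)" if "\<forall>i<n. x i = y i" for x y z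
    using assms that unfolding local_fun_def by (metis (no_types, lifting))
  then show ?thesis unfolding local_fun_def smooth_def by (intro allI impI Bochner_Integration.integral_cong refl)
qed

lemma smooth_bounds:
  assumes "prob_space \<mu>" "sets \<mu> = sets (lebesgue_n n)" and cont: "continuous_on UNIV u"
    and u: "\<And>x. 0 < u x" "\<And>x. u x \<le> 1"
  shows "0 < smooth \<mu> c u x" "smooth \<mu> c u x \<le> 1"
proof -
  interpret prob_space \<mu> by fact
  have int: "integrable \<mu> (\<lambda>y. u (\<lambda>i. x i - c * y i))"
    by (rule integrable_shift[OF assms(1,2) cont less_imp_le[OF u(1)] u(2)])
  show "0 < smooth \<mu> c u x"
    unfolding smooth_def using int u(1) by (intro expectation_greater) auto
  have "smooth \<mu> c u x \<le> (\<integral>y. 1 \<partial>\<mu>)"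
    unfolding smooth_def using int u(2) by (intro integral_mono) auto
  then show "smooth \<mu> c u x \<le> 1" using prob_space by simp
qed

section \<open>Half-space integrals and lower bounds for convolutions\<close>

definition halfspace_integral :: "nat \<Rightarrow> ((nat \<Rightarrow> real) \<Rightarrow> real) \<Rightarrow> (nat \<Rightarrow> real) \<Rightarrow> real \<Rightarrow> ennreal" where
  "halfspace_integral n u a b = (\<integral>\<^sup>+z. ennreal (u z) * (if b \<le> (\<Sum>i<n. a i * z i) then 1 else 0) \<partial>lebesgue_n n)"

lemma halfspace_integral_mono:
  "b' \<le> b \<Longrightarrow> halfspace_integral n u a b \<le> halfspace_integral n u a b'"
  unfolding halfspace_integral_def by (intro nn_integral_mono) auto

text \<open>By Tonelli the integral over \<open>z\<close> can be taken first; translating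
  \<open>z\<close> by \<open>c * y\<close> then moves the shift from the argument of
  \<open>u\<close> into the threshold.\<close>

lemma halfspace_integral_smooth:
  assumes "prob_space \<mu>" "sets \<mu> = sets (lebesgue_n n)" and cont: "continuous_on UNIV u"
    and u: "\<And>x. 0 \<le> u x" "\<And>x. u x \<le> 1" and loc: "local_fun n u"
  shows "halfspace_integral n (smooth \<mu> c u) a b
    = (\<integral>\<^sup>+y. halfspace_integral n u a (b - c * (\<Sum>i<n. a i * y i)) \<partial>\<mu>)"
proof -
  interpret prob_space \<mu> by fact
  interpret P: pair_sigma_finite "lebesgue_n n" \<mu>
    by (intro pair_sigma_finite.intro sigma_finite_lebesgue_n sigma_finite_measure_axioms)
  have [measurable]: "u \<in> borel_measurable borel" by (rule borel_measurable_continuous_onI[OF cont])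
  have co[measurable]: "(\<lambda>p. fst p i) \<in> borel_measurable (lebesgue_n n \<Otimes>\<^sub>M \<mu>)"
      "(\<lambda>p. snd p i) \<in> borel_measurable (lebesgue_n n \<Otimes>\<^sub>M \<mu>)" for i
    using measurable_compose[OF measurable_fst measurable_coord[OF refl]]
      measurable_compose[OF measurable_snd measurable_coord[OF assms(2)]] by auto
  have shift: "(\<lambda>p i. fst p i - c * snd p i) \<in> measurable (lebesgue_n n \<Otimes>\<^sub>M \<mu>) borel"
    by (rule measurable_coordinatewise_then_product)
      (intro borel_measurable_diff borel_measurable_times borel_measurable_const co)
  have m2[measurable]: "(\<lambda>p. u (\<lambda>i. fst p i - c * snd p i)) \<in> borel_measurable (lebesgue_n n \<Otimes>\<^sub>M \<mu>)"
    using measurable_compose[OF shift, of u borel] by simp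
  have "halfspace_integral n (smooth \<mu> c u) a b
     = (\<integral>\<^sup>+z. (\<integral>\<^sup>+y. ennreal (u (\<lambda>i. z i - c * y i)) * (if b \<le> (\<Sum>i<n. a i * z i) then 1 else 0) \<partial>\<mu>) \<partial>lebesgue_n n)"
    unfolding halfspace_integral_def
  proof (rule nn_integral_cong)
    fix z
    have "ennreal (smooth \<mu> c u z) = (\<integral>\<^sup>+y. ennreal (u (\<lambda>i. z i - c * y i)) \<partial>\<mu>)"
      unfolding smooth_def using u
      by (intro nn_integral_eq_integral[symmetric] integrable_shift[OF assms(1,2) cont]) auto
    then show "ennreal (smooth \<mu> c u z) * (if b \<le> (\<Sum>i<n. a i * z i) then 1 else 0)
      = (\<integral>\<^sup>+y. ennreal (u (\<lambda>i. z i - c * y i)) * (if b \<le> (\<Sum>i<n. a i * z i) then 1 else 0) \<partial>\<mu>)"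
      by simp
  qed
  also have "\<dots> = (\<integral>\<^sup>+y. (\<integral>\<^sup>+z. ennreal (u (\<lambda>i. z i - c * y i)) * (if b \<le> (\<Sum>i<n. a i * z i) then 1 else 0) \<partial>lebesgue_n n) \<partial>\<mu>)"
    by (rule P.Fubini'[symmetric]) (simp add: case_prod_beta')
  also have "\<dots> = (\<integral>\<^sup>+y. halfspace_integral n u a (b - c * (\<Sum>i<n. a i * y i)) \<partial>\<mu>)"
  proof (rule nn_integral_cong)
    fix y :: "nat \<Rightarrow> real"
    let ?w = "\<lambda>z. ennreal (u (\<lambda>i. z i - c * y i)) * (if b \<le> (\<Sum>i<n. a i * z i) then 1 else 0)"
    have [measurable]: "(\<lambda>x::nat \<Rightarrow> real. x i) \<in> borel_measurable borel" for i
      by (intro borel_measurable_continuous_onI continuous_on_product_coordinates)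
    have [measurable]: "(\<lambda>z. u (\<lambda>i. z i - c * y i)) \<in> borel_measurable borel"
      by (rule borel_measurable_continuous_onI[OF continuous_on_shift(2)[OF cont]])
    have w: "?w \<in> borel_measurable borel" by measurable
    have lw: "local_fun n ?w"
      unfolding local_fun_def
    proof (intro allI impI)
      fix x x' :: "nat \<Rightarrow> real" assume eq: "\<forall>i<n. x i = x' i"
      then have "u (\<lambda>i. x i - c * y i) = u (\<lambda>i. x' i - c * y i)"
        using loc unfolding local_fun_def by (metis (no_types, lifting))
      moreover have "(\<Sum>i<n. a i * x i) = (\<Sum>i<n. a i * x' i)" using eq by (intro sum.cong) auto
      ultimately show "?w x = ?w x'" by simp
    qed
    have "integral\<^sup>N (lebesgue_n n) ?w = (\<integral>\<^sup>+z. ?w (\<lambda>i. c * y i + 1 * z i) \<partial>lebesgue_n n)"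
      using nn_integral_lebesgue_n_affine[OF w lw, of 1 "\<lambda>i. c * y i"] by simp
    also have "\<dots> = halfspace_integral n u a (b - c * (\<Sum>i<n. a i * y i))"
      unfolding halfspace_integral_def
      by (intro nn_integral_cong) (auto simp: algebra_simps sum.distrib sum_distrib_left)
    finally show "integral\<^sup>N (lebesgue_n n) ?w = halfspace_integral n u a (b - c * (\<Sum>i<n. a i * y i))" .
  qed
  finally show ?thesis .
qed

text \<open>Jensen's inequality: averaged over \<open>y\<close>, the quadratic form at
  \<open>x - c * y\<close> loses its cross term because the barycenter is 0, and gains
  \<open>c\<^sup>2 * real n\<close> from the unit variances. The free constant \<open>k\<close> lets
  the estimate be iterated.\<close>

lemma smooth_gauss_lower:
  assumes "prob_space \<mu>" "sets \<mu> = sets (lebesgue_n n)" "isotropic n \<mu>" and cont: "continuous_on UNIV u"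
    and u: "\<And>x. 0 \<le> u x" "\<And>x. u x \<le> 1"
    and low: "\<And>x. exp (- (s / 2 * ((\<Sum>i<n. (x i)\<^sup>2) + k))) \<le> u x"
  shows "exp (- (s / 2 * ((\<Sum>i<n. (x i)\<^sup>2) + (c\<^sup>2 * real n + k)))) \<le> smooth \<mu> c u x"
proof -
  interpret prob_space \<mu> by fact
  \<comment> \<open>The exponent of the lower bound at \<open>x - c * y\<close>, expanded so that
    only the moments controlled by isotropy occur.\<close>
  define q where "q y = - (s / 2 * ((\<Sum>i<n. (x i)\<^sup>2 - 2 * c * x i * y i + c\<^sup>2 * (y i * y i)) + k))" for y :: "nat \<Rightarrow> real"
  define m where "m = - (s / 2 * ((\<Sum>i<n. (x i)\<^sup>2) + (c\<^sup>2 * real n + k)))"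
  have iso: "integrable \<mu> (\<lambda>y. y i)" "(\<integral>y. y i \<partial>\<mu>) = 0" "integrable \<mu> (\<lambda>y. y i * y i)" "(\<integral>y. y i * y i \<partial>\<mu>) = 1"
    if "i < n" for i using assms(3) that by (auto simp: isotropic_def)
  have q_int_i: "integrable \<mu> (\<lambda>y. (x i)\<^sup>2 - 2 * c * x i * y i + c\<^sup>2 * (y i * y i))" if "i < n" for i
    using iso[OF that] by auto
  have q_int: "integrable \<mu> q"
    unfolding q_def[abs_def]
    by (intro integrable_minus integrable_mult_right Bochner_Integration.integrable_add
        Bochner_Integration.integrable_sum integrable_const q_int_i) auto
  have "(\<integral>y. q y \<partial>\<mu>) = - (s / 2 * ((\<Sum>i<n. \<integral>y. (x i)\<^sup>2 - 2 * c * x i * y i + c\<^sup>2 * (y i * y i) \<partial>\<mu>) + k))"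
  proof -
    have "(\<integral>y. (\<Sum>i<n. (x i)\<^sup>2 - 2 * c * x i * y i + c\<^sup>2 * (y i * y i)) + k \<partial>\<mu>)
        = (\<integral>y. (\<Sum>i<n. (x i)\<^sup>2 - 2 * c * x i * y i + c\<^sup>2 * (y i * y i)) \<partial>\<mu>) + (\<integral>y. k \<partial>\<mu>)"
      using q_int_i by (intro Bochner_Integration.integral_add Bochner_Integration.integrable_sum integrable_const) auto
    also have "(\<integral>y. (\<Sum>i<n. (x i)\<^sup>2 - 2 * c * x i * y i + c\<^sup>2 * (y i * y i)) \<partial>\<mu>)
        = (\<Sum>i<n. \<integral>y. (x i)\<^sup>2 - 2 * c * x i * y i + c\<^sup>2 * (y i * y i) \<partial>\<mu>)"
      using q_int_i by (intro Bochner_Integration.integral_sum) auto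
    finally show ?thesis by (simp add: q_def prob_space)
  qed
  also have "(\<Sum>i<n. \<integral>y. (x i)\<^sup>2 - 2 * c * x i * y i + c\<^sup>2 * (y i * y i) \<partial>\<mu>) = (\<Sum>i<n. (x i)\<^sup>2 + c\<^sup>2)"
    using iso prob_space by (intro sum.cong) auto
  finally have q_m: "(\<integral>y. q y \<partial>\<mu>) = m" by (simp add: m_def sum.distrib algebra_simps)
  \<comment> \<open>Jensen by hand: the tangent line of \<open>exp\<close> at the mean
    \<open>m\<close> of \<open>q\<close> lies below \<open>exp\<close> and integrates to
    \<open>exp m\<close>.\<close>
  have "exp m = (\<integral>y. exp m * (1 + (q y - m)) \<partial>\<mu>)"
    using q_int q_m prob_space by simp
  also have "\<dots> \<le> smooth \<mu> c u x"
    unfolding smooth_def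
  proof (rule integral_mono)
    show "integrable \<mu> (\<lambda>y. exp m * (1 + (q y - m)))" using q_int by simp
    show "integrable \<mu> (\<lambda>y. u (\<lambda>i. x i - c * y i))" by (rule integrable_shift[OF assms(1,2) cont u])
    fix y
    have "exp m * (1 + (q y - m)) \<le> exp m * exp (q y - m)"
      by (intro mult_left_mono exp_ge_add_one_self) auto
    also have "\<dots> = exp (q y)" by (simp add: exp_add[symmetric])
    also have "exp (q y) = exp (- (s / 2 * ((\<Sum>i<n. (x i - c * y i)\<^sup>2) + k)))"
      by (simp add: q_def power2_eq_square algebra_simps)
    also have "\<dots> \<le> u (\<lambda>i. x i - c * y i)" by (rule low)
    finally show "exp m * (1 + (q y - m)) \<le> u (\<lambda>i. x i - c * y i)" .
  qed
  finally show ?thesis by (simp add: m_def)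
qed

section \<open>Separation by a nearest point\<close>

lemma log_concave_level_comb:
  assumes u: "log_concave_fun u" and r: "0 < r" "r \<le> u x" "r \<le> u y" and t: "0 < t" "t < 1"
  shows "r \<le> u (\<lambda>i. t * x i + (1 - t) * y i)"
proof -
  have "r = r powr t * r powr (1 - t)" using r by (simp add: powr_add[symmetric])
  also have "\<dots> \<le> u x powr t * u y powr (1 - t)"
    using r t by (intro mult_mono powr_mono2) auto
  also have "\<dots> \<le> u (\<lambda>i. t * x i + (1 - t) * y i)" using u t by (auto simp: log_concave_fun_def)
  finally show ?thesis .
qed

text \<open>The points of \<open>K\<close> no farther from \<open>x\<close> than some chosen
  \<open>z1\<close> form a closed subset of a compact cube, so the continuous squared distance
  attains its minimum there.\<close>

lemma nearest_point_Rn: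
  assumes K: "closed K" "K \<subseteq> Rn n" "K \<noteq> {}"
  obtains z where "z \<in> K" "\<And>w. w \<in> K \<Longrightarrow> (\<Sum>i<n. (z i - x i)\<^sup>2) \<le> (\<Sum>i<n. (w i - x i)\<^sup>2)"
proof -
  let ?d = "\<lambda>z. \<Sum>i<n. (z i - x i)\<^sup>2"
  obtain z1 where z1: "z1 \<in> K" using K by auto
  define R where "R = sqrt (?d z1)"
  define B where "B = K \<inter> {z. ?d z \<le> ?d z1}"
  have d_cont: "continuous_on S ?d" for S
    by (intro continuous_intros continuous_on_subset[OF continuous_on_product_coordinates]) auto
  have "B \<subseteq> Pi\<^sub>E {..<n} (\<lambda>i. {x i - R..x i + R})"
  proof
    fix z assume z: "z \<in> B"
    have "\<bar>z i - x i\<bar> \<le> R" if "i < n" for i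
    proof -
      have "(z i - x i)\<^sup>2 \<le> ?d z" using that by (intro member_le_sum) auto
      also have "\<dots> \<le> ?d z1" using z by (simp add: B_def)
      finally have "sqrt ((z i - x i)\<^sup>2) \<le> R" unfolding R_def by (rule real_sqrt_le_mono)
      then show ?thesis by simp
    qed
    then show "z \<in> Pi\<^sub>E {..<n} (\<lambda>i. {x i - R..x i + R})"
      using z K(2) by (auto simp: B_def Rn_def PiE_def Pi_def abs_le_iff dest!: subsetD)
        (smt (verit))+
  qed
  moreover have "closed B"
    unfolding B_def using K d_cont by (intro closed_Int closed_Collect_le continuous_on_const) auto
  moreover have "compact (Pi\<^sub>E {..<n} (\<lambda>i. {x i - R..x i + R}))" by (intro compact_PiE_fun) auto
  ultimately have "compact B" by (metis closed_Int_compact inf.absorb1)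
  then obtain z where z: "z \<in> B" "\<forall>w\<in>B. ?d z \<le> ?d w"
    using continuous_attains_inf[of B ?d] d_cont z1 by (auto simp: B_def)
  show thesis
  proof
    show "z \<in> K" using z by (simp add: B_def)
    show "?d z \<le> ?d w" if "w \<in> K" for w
    proof (cases "w \<in> B")
      case True then show ?thesis using z by simp
    next
      case False
      then have "?d z1 < ?d w" using that by (simp add: B_def)
      moreover have "?d z \<le> ?d z1" using z(1) by (simp add: B_def)
      ultimately show ?thesis by linarith
    qed
  qed
qed

text \<open>The set \<open>K\<close> where \<open>u\<close> is at least \<open>r\<close> is closed,
  convex and misses \<open>x\<close>. The vector from its nearest point \<open>p\<close> to
  \<open>x\<close> is normal to a half-space through \<open>x\<close> that avoids
  \<open>K\<close>.\<close>

lemma halfspace_below_level: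
  assumes n: "0 < n" and cont: "continuous_on UNIV u" and lu: "log_concave_fun u"
    and x: "x \<in> Rn n" and r: "0 < r" "u x < r"
  obtains a where "\<exists>i<n. a i \<noteq> 0"
    "\<And>z. z \<in> Rn n \<Longrightarrow> (\<Sum>i<n. a i * x i) \<le> (\<Sum>i<n. a i * z i) \<Longrightarrow> u z < r"
proof -
  define K where "K = {z \<in> Rn n. r \<le> u z}"
  have K: "closed K" "K \<subseteq> Rn n"
    unfolding K_def Collect_conj_eq using closed_Rn cont by (auto intro!: closed_Int closed_Collect_le)
  show thesis
  proof (cases "K = {}")
    case True
    \<comment> \<open>Every nonzero normal works here, and \<open>0 < n\<close> provides
      one.\<close>
    then show thesis using n by (intro that[of "\<lambda>_. 1"]) (auto simp: K_def not_le)
  next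
    case False
    obtain p where p: "p \<in> K" and min: "\<And>w. w \<in> K \<Longrightarrow> (\<Sum>i<n. (p i - x i)\<^sup>2) \<le> (\<Sum>i<n. (w i - x i)\<^sup>2)"
      using nearest_point_Rn[OF K False] by blast
    define a where "a i = x i - p i" for i
    define A where "A = (\<Sum>i<n. (a i)\<^sup>2)"
    have "p \<noteq> x" using p r by (auto simp: K_def)
    have ex: "\<exists>i<n. a i \<noteq> 0"
    proof (rule ccontr)
      assume "\<not> ?thesis"
      then have "p = x" using x p K(2) by (intro extensionalityI[of p "{..<n}" x]) (auto simp: a_def Rn_def PiE_def)
      then show False using \<open>p \<noteq> x\<close> by simp
    qed
    have A: "0 < A"
    proof -
      obtain i where i: "i < n" "a i \<noteq> 0" using ex by blast
      have "(a i)\<^sup>2 \<le> A" unfolding A_def using i by (intro member_le_sum) auto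
      then show ?thesis using i by (meson less_le_trans zero_less_power2)
    qed
    show thesis
    proof (rule that[OF ex])
      fix z assume z: "z \<in> Rn n" "(\<Sum>i<n. a i * x i) \<le> (\<Sum>i<n. a i * z i)"
      show "u z < r"
      proof (rule ccontr)
        assume "\<not> u z < r"
        then have zK: "z \<in> K" using z by (simp add: K_def)
        define Z where "Z = (\<Sum>i<n. (z i - p i)\<^sup>2)"
        have Z: "0 \<le> Z" by (simp add: Z_def sum_nonneg)
        \<comment> \<open>This \<open>t\<close> is small enough for \<open>t * Z < A\<close>: moving
          from \<open>p\<close> towards \<open>z\<close> by the fraction \<open>t\<close> then
          brings the point strictly closer to \<open>x\<close>, against the choice of
          \<open>p\<close>.\<close>
        define t where "t = A / (A + Z + 1)"
        have t: "0 < t" "t < 1" "t * Z < A"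
          using A Z mult_pos_pos[OF A A] by (auto simp: t_def field_simps intro: add_pos_pos)
        define w where "w = (\<lambda>i. t * z i + (1 - t) * p i)"
        have "w \<in> K"
          using log_concave_level_comb[OF lu r(1) _ _ t(1,2), of z p] comb_in_Rn[of z n p t] zK p
          by (simp add: K_def w_def)
        have "A = (\<Sum>i<n. a i * x i) - (\<Sum>i<n. a i * p i)"
          by (simp add: A_def a_def power2_eq_square sum_subtractf[symmetric] algebra_simps)
        also have "\<dots> \<le> (\<Sum>i<n. a i * z i) - (\<Sum>i<n. a i * p i)" using z by simp
        also have "\<dots> = (\<Sum>i<n. a i * (z i - p i))" by (simp add: sum_subtractf algebra_simps)
        finally have dot: "A \<le> (\<Sum>i<n. a i * (z i - p i))" .
        have "(\<Sum>i<n. (w i - x i)\<^sup>2) = (\<Sum>i<n. (a i)\<^sup>2 - 2 * t * (a i * (z i - p i)) + t * t * (z i - p i)\<^sup>2)"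
          by (intro sum.cong refl) (simp add: w_def a_def power2_eq_square algebra_simps)
        also have "\<dots> = A - 2 * t * (\<Sum>i<n. a i * (z i - p i)) + t * (t * Z)"
          by (simp add: sum.distrib sum_subtractf sum_distrib_left A_def Z_def mult.assoc)
        also have "\<dots> < A - 2 * t * A + t * A"
          using t dot by (intro add_le_less_mono diff_left_mono mult_left_mono mult_strict_left_mono) auto
        also have "\<dots> \<le> A" using t A by simp
        also have "A = (\<Sum>i<n. (p i - x i)\<^sup>2)" by (simp add: A_def a_def power2_commute)
        finally show False using min[OF \<open>w \<in> K\<close>] by simp
      qed
    qed
  qed
qed

section \<open>Tukey depth and the Gaussian iterates\<close>

text \<open>A half-space bounded by a hyperplane through 0 and its reflection cover the space, and
  the Gaussian is even.\<close>

lemma halfspace_integral_gauss: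
  assumes s: "0 < s"
  shows "ennreal (sqrt (2 * pi / s) ^ n) \<le> 2 * halfspace_integral n (gauss n s) a 0"
proof -
  let ?I = "\<lambda>z. if 0 \<le> (\<Sum>i<n. a i * z i) then 1 else 0 :: ennreal"
  let ?w = "\<lambda>z. ennreal (gauss n s z) * ?I z"
  have co[measurable]: "(\<lambda>x::nat \<Rightarrow> real. x i) \<in> borel_measurable borel" for i
    by (intro borel_measurable_continuous_onI continuous_on_product_coordinates)
  have [measurable]: "gauss n s \<in> borel_measurable borel"
    by (rule borel_measurable_continuous_onI[OF continuous_on_gauss])
  have w: "?w \<in> borel_measurable borel" by measurable
  have lw: "local_fun n ?w"
    unfolding local_fun_def
  proof (intro allI impI)
    fix x x' :: "nat \<Rightarrow> real" assume eq: "\<forall>i<n. x i = x' i"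
    then have "gauss n s x = gauss n s x'" using local_gauss unfolding local_fun_def by blast
    moreover have "(\<Sum>i<n. a i * x i) = (\<Sum>i<n. a i * x' i)" using eq by (intro sum.cong) auto
    ultimately show "?w x = ?w x'" by simp
  qed
  have wm: "?w \<in> borel_measurable (lebesgue_n n)"
    using measurable_compose[OF measurable_id_borel[OF refl] w] .
  have wm': "(\<lambda>z. ?w (\<lambda>i. - z i)) \<in> borel_measurable (lebesgue_n n)"
  proof -
    have "(\<lambda>x. \<lambda>i. 0 + (-1) * x i) \<in> measurable borel (borel :: (nat \<Rightarrow> real) measure)"
      by (rule measurable_affine_coords)
    from measurable_compose[OF measurable_compose[OF measurable_id_borel[OF refl] this] w]
    show ?thesis by simp
  qed
  have refl': "halfspace_integral n (gauss n s) a 0 = (\<integral>\<^sup>+z. ?w (\<lambda>i. - z i) \<partial>lebesgue_n n)"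
    unfolding halfspace_integral_def
    using nn_integral_lebesgue_n_affine[OF w lw, of "-1" "\<lambda>_. 0"] by simp
  have "ennreal (sqrt (2 * pi / s) ^ n) = (\<integral>\<^sup>+z. ennreal (gauss n s z) \<partial>lebesgue_n n)"
    unfolding gauss_def using nn_integral_gaussian[OF s, of n] by simp
  also have "\<dots> \<le> (\<integral>\<^sup>+z. ?w z + ?w (\<lambda>i. - z i) \<partial>lebesgue_n n)"
  proof (rule nn_integral_mono)
    fix z :: "nat \<Rightarrow> real"
    have "gauss n s (\<lambda>i. - z i) = gauss n s z" by (simp add: gauss_def)
    then show "ennreal (gauss n s z) \<le> ?w z + ?w (\<lambda>i. - z i)"
      by (auto simp: sum_negf)
  qed
  also have "\<dots> = (\<integral>\<^sup>+z. ?w z \<partial>lebesgue_n n) + (\<integral>\<^sup>+z. ?w (\<lambda>i. - z i) \<partial>lebesgue_n n)"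
    by (rule nn_integral_add[OF wm wm'])
  also have "(\<integral>\<^sup>+z. ?w z \<partial>lebesgue_n n) = halfspace_integral n (gauss n s) a 0"
    unfolding halfspace_integral_def by (rule refl)
  also have "(\<integral>\<^sup>+z. ?w (\<lambda>i. - z i) \<partial>lebesgue_n n) = halfspace_integral n (gauss n s) a 0"
    by (rule refl'[symmetric])
  finally show ?thesis by (simp only: mult_2)
qed

text \<open>The vector \<open>a = 0\<close> encodes the whole space.\<close>

lemma halfspace_integral_0: "halfspace_integral n u (\<lambda>_. 0) 0 = (\<integral>\<^sup>+z. ennreal (u z) \<partial>lebesgue_n n)"
  by (simp add: halfspace_integral_def)

text \<open>Up to normalization, the density at \<open>x\<close> of \<open>G + (y\<^sub>1 + \<dots> + y\<^sub>k) / s\<close> with \<open>y\<^sub>i\<close> independent of law \<open>\<mu>\<close> and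
  \<open>G\<close> centred Gaussian of covariance \<open>1 / s\<close>.\<close>

definition gauss_iter :: "nat \<Rightarrow> (nat \<Rightarrow> real) measure \<Rightarrow> real \<Rightarrow> nat \<Rightarrow> (nat \<Rightarrow> real) \<Rightarrow> real" where
  "gauss_iter n \<mu> s k = (smooth \<mu> (1 / s) ^^ k) (gauss n s)"

lemma gauss_iter_simps:
  "gauss_iter n \<mu> s 0 = gauss n s"
  "gauss_iter n \<mu> s (Suc k) = smooth \<mu> (1 / s) (gauss_iter n \<mu> s k)"
  by (simp_all add: gauss_iter_def)

section \<open>Iterated convolutions of the Gaussian\<close>

context
  fixes n :: nat and \<mu> :: "(nat \<Rightarrow> real) measure" and s :: real
  assumes lc: "log_concave_prob n \<mu>" and iso: "isotropic n \<mu>" and s: "0 < s"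
begin

lemma prob_space_sets: "prob_space \<mu>" "sets \<mu> = sets (lebesgue_n n)"
  using lc by (simp_all add: log_concave_prob_def)

lemma gauss_iter_basic:
  "continuous_on UNIV (gauss_iter n \<mu> s k) \<and> (\<forall>x. 0 < gauss_iter n \<mu> s k x) \<and> (\<forall>x. gauss_iter n \<mu> s k x \<le> 1)
     \<and> local_fun n (gauss_iter n \<mu> s k) \<and> log_concave_fun (gauss_iter n \<mu> s k)"
proof (induction k)
  case 0
  show ?case using s
    by (auto simp: gauss_iter_simps continuous_on_gauss gauss_pos gauss_le_1 local_gauss log_concave_gauss)
next
  case (Suc k)
  then show ?case
    by (auto simp: gauss_iter_simps less_imp_le intro!: continuous_on_smooth[OF prob_space_sets] smooth_bounds[OF prob_space_sets] local_smooth log_concave_smooth[OF lc])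
qed

lemmas gauss_iter_cont = gauss_iter_basic[THEN conjunct1]
lemmas gauss_iter_pos = gauss_iter_basic[THEN conjunct2, THEN conjunct1, rule_format]
lemmas gauss_iter_le_1 = gauss_iter_basic[THEN conjunct2, THEN conjunct2, THEN conjunct1, rule_format]
lemmas gauss_iter_local = gauss_iter_basic[THEN conjunct2, THEN conjunct2, THEN conjunct2, THEN conjunct1]
lemmas gauss_iter_log_concave = gauss_iter_basic[THEN conjunct2, THEN conjunct2, THEN conjunct2, THEN conjunct2]

lemma halfspace_integral_gauss_iter_Suc:
  "halfspace_integral n (gauss_iter n \<mu> s (Suc k)) a b
    = (\<integral>\<^sup>+y. halfspace_integral n (gauss_iter n \<mu> s k) a (b - 1 / s * (\<Sum>i<n. a i * y i)) \<partial>\<mu>)"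
  unfolding gauss_iter_simps
  by (intro halfspace_integral_smooth[OF prob_space_sets] gauss_iter_cont gauss_iter_local gauss_iter_le_1 less_imp_le[OF gauss_iter_pos])

text \<open>Convolution with a probability measure preserves total mass; the induction step is the
  case \<open>a = 0\<close> of the half-space recursion.\<close>

lemma gauss_iter_integral:
  "(\<integral>\<^sup>+z. ennreal (gauss_iter n \<mu> s k z) \<partial>lebesgue_n n) = ennreal (sqrt (2 * pi / s) ^ n)"
proof (induction k)
  case 0
  then show ?case unfolding gauss_iter_simps gauss_def using nn_integral_gaussian[OF s, of n] by simp
next
  case (Suc k)
  then show ?case
    using halfspace_integral_gauss_iter_Suc[of k "\<lambda>_. 0" 0] prob_space.emeasure_space_1[OF prob_space_sets(1)]
    by (simp add: halfspace_integral_0)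
qed

text \<open>Each convolution adds \<open>(1 / s)\<^sup>2 * real n\<close>, the second moment of
  \<open>y / s\<close>. For \<open>k = s\<close> the value at 0 is therefore at least
  \<open>exp (- n / 2)\<close>.\<close>

lemma gauss_iter_lower:
  "exp (- (s / 2 * ((\<Sum>i<n. (x i)\<^sup>2) + real k * (1 / s)\<^sup>2 * real n))) \<le> gauss_iter n \<mu> s k x"
proof (induction k arbitrary: x)
  case 0
  then show ?case by (simp add: gauss_iter_simps gauss_def)
next
  case (Suc k)
  have "exp (- (s / 2 * ((\<Sum>i<n. (x i)\<^sup>2) + ((1 / s)\<^sup>2 * real n + real k * (1 / s)\<^sup>2 * real n)))) \<le> gauss_iter n \<mu> s (Suc k) x"
    unfolding gauss_iter_simps
    by (intro smooth_gauss_lower[OF prob_space_sets iso] gauss_iter_cont gauss_iter_le_1 less_imp_le[OF gauss_iter_pos] Suc)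
  also have "(1 / s)\<^sup>2 * real n + real k * (1 / s)\<^sup>2 * real n = real (Suc k) * (1 / s)\<^sup>2 * real n"
    by (simp add: algebra_simps)
  finally show ?case .
qed

text \<open>In each convolution only the samples \<open>y\<close> in \<open>H\<close> are kept. They
  have probability \<open>measure \<mu> H\<close>, and each lowers the threshold by at least
  \<open>b / s\<close>.\<close>

lemma halfspace_integral_gauss_iter_lower:
  fixes H a b
  defines "H \<equiv> {y \<in> Rn n. b \<le> (\<Sum>i<n. a i * y i)}"
  shows "ennreal (measure \<mu> H ^ k) * halfspace_integral n (gauss n s) a (\<beta> - real k * (b / s))
    \<le> halfspace_integral n (gauss_iter n \<mu> s k) a \<beta>"
proof (induction k arbitrary: \<beta>)
  case 0
  then show ?case by (simp add: gauss_iter_simps)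
next
  case (Suc k)
  interpret prob_space \<mu> by (rule prob_space_sets)
  have sp: "space \<mu> = Rn n" using sets_eq_imp_space_eq[OF prob_space_sets(2)] by (simp add: space_lebesgue_n)
  have co[measurable]: "(\<lambda>x. x i) \<in> borel_measurable \<mu>" for i by (rule measurable_coord[OF prob_space_sets(2)])
  have H: "H \<in> sets \<mu>"
  proof -
    have "{y \<in> space \<mu>. b \<le> (\<Sum>i<n. a i * y i)} \<in> sets \<mu>" by measurable
    then show ?thesis by (simp add: H_def sp)
  qed
  let ?J = "halfspace_integral n (gauss_iter n \<mu> s k) a (\<beta> - b / s)"
  have "ennreal (measure \<mu> H ^ Suc k) * halfspace_integral n (gauss n s) a (\<beta> - real (Suc k) * (b / s))
    = ennreal (measure \<mu> H) * (ennreal (measure \<mu> H ^ k) * halfspace_integral n (gauss n s) a ((\<beta> - b / s) - real k * (b / s)))"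
    by (simp add: ennreal_mult mult.assoc algebra_simps add_divide_distrib)
  also have "\<dots> \<le> ennreal (measure \<mu> H) * ?J"
    by (intro mult_left_mono Suc.IH) auto
  also have "\<dots> = (\<integral>\<^sup>+y. ?J * indicator H y \<partial>\<mu>)"
    using H by (subst nn_integral_cmult_indicator) (simp_all add: emeasure_eq_measure mult.commute)
  also have "\<dots> \<le> (\<integral>\<^sup>+y. halfspace_integral n (gauss_iter n \<mu> s k) a (\<beta> - 1 / s * (\<Sum>i<n. a i * y i)) \<partial>\<mu>)"
  proof (rule nn_integral_mono)
    fix y
    show "?J * indicator H y \<le> halfspace_integral n (gauss_iter n \<mu> s k) a (\<beta> - 1 / s * (\<Sum>i<n. a i * y i))"
      using s by (auto simp: H_def indicator_def divide_right_mono intro!: halfspace_integral_mono)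
  qed
  also have "\<dots> = halfspace_integral n (gauss_iter n \<mu> s (Suc k)) a \<beta>"
    by (rule halfspace_integral_gauss_iter_Suc[symmetric])
  finally show ?case .
qed

end

text \<open>Ensures that the infimum defining \<open>tukey_depth\<close> runs over a nonempty set;
  \<open>0 < n\<close> is what allows a nonzero normal.\<close>

lemma halfspace_n_through_point:
  assumes "0 < n" "x \<in> Rn n"
  obtains H where "halfspace_n n H" "x \<in> H"
proof
  show "halfspace_n n {z \<in> Rn n. (\<Sum>i<n. 1 * z i) \<ge> (\<Sum>i<n. 1 * x i)}"
    unfolding halfspace_n_def using assms(1) by (intro exI[of _ "\<lambda>_. 1"]) auto
qed (use assms(2) in simp)

lemma tukey_depth_nonneg:
  assumes "0 < n" "x \<in> Rn n"
  shows "0 \<le> tukey_depth n \<mu> x"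
proof -
  obtain H where "halfspace_n n H" "x \<in> H" using halfspace_n_through_point[OF assms] by blast
  then show ?thesis unfolding tukey_depth_def by (intro cInf_greatest) auto
qed

lemma tukey_depth_le: "halfspace_n n H \<Longrightarrow> x \<in> H \<Longrightarrow> tukey_depth n \<mu> x \<le> measure \<mu> H"
  unfolding tukey_depth_def by (intro cInf_lower bdd_belowI[of _ 0]) auto

lemma tukey_depth_le_1:
  assumes "prob_space \<mu>" "0 < n" "x \<in> Rn n"
  shows "tukey_depth n \<mu> x \<le> 1"
proof -
  obtain H where "halfspace_n n H" "x \<in> H" using halfspace_n_through_point[OF assms(2,3)] by blast
  then have "tukey_depth n \<mu> x \<le> measure \<mu> H" by (rule tukey_depth_le)
  also have "\<dots> \<le> 1" by (rule prob_space.prob_le_1[OF assms(1)])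
  finally show ?thesis .
qed

section \<open>Pointwise bound for powers of the depth\<close>

context
  fixes n :: nat and \<mu> :: "(nat \<Rightarrow> real) measure" and m :: nat
  assumes lc: "log_concave_prob n \<mu>" and iso: "isotropic n \<mu>" and n: "0 < n" and m: "0 < m"
begin

lemma of_nat_scale_pos: "0 < real m" using m by simp

lemmas gauss_iter_cont_nat = gauss_iter_cont[OF lc iso of_nat_scale_pos]
lemmas gauss_iter_pos_nat = gauss_iter_pos[OF lc iso of_nat_scale_pos]

text \<open>Log-concavity at the midpoint of \<open>z\<close> and 0 bounds
  \<open>sqrt (h z) * sqrt (h 0)\<close> by \<open>h (z / 2)\<close>. The lower bound at 0 costs
  \<open>exp (n / 4)\<close>, and undoing the halving of \<open>z\<close> costs
  \<open>2 ^ n\<close>.\<close>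

lemma gauss_iter_sqrt_integral:
  "(\<integral>\<^sup>+z. ennreal (sqrt (gauss_iter n \<mu> m m z)) \<partial>lebesgue_n n)
    \<le> ennreal (2 ^ n * exp (real n / 4) * sqrt (2 * pi / m) ^ n)"
proof -
  let ?h = "gauss_iter n \<mu> (real m) m"
  have [measurable]: "?h \<in> borel_measurable borel"
    by (rule borel_measurable_continuous_onI[OF gauss_iter_cont_nat])
  have h0: "exp (- (real n / 2)) \<le> ?h (\<lambda>_. 0)"
    using gauss_iter_lower[OF lc iso of_nat_scale_pos, of "\<lambda>_. 0" m] m by (simp add: power2_eq_square)
  have pt: "sqrt (?h z) \<le> exp (real n / 4) * ?h (\<lambda>i. 0 + 1/2 * z i)" for z
  proof -
    have "exp (- (real n / 4)) = sqrt (exp (- (real n / 2)))"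
      by (rule real_sqrt_unique[symmetric]) (auto simp: power2_eq_square exp_add[symmetric])
    also have "\<dots> \<le> sqrt (?h (\<lambda>_. 0))" using h0 by simp
    finally have "sqrt (?h z) * exp (- (real n / 4)) \<le> sqrt (?h z) * sqrt (?h (\<lambda>_. 0))"
      using gauss_iter_pos_nat[of m z] by (intro mult_left_mono) auto
    also have "\<dots> = ?h z powr (1/2) * ?h (\<lambda>_. 0) powr (1 - 1/2)"
      using gauss_iter_pos_nat[of m z] gauss_iter_pos_nat[of m "\<lambda>_. 0"] by (simp add: powr_half_sqrt)
    also have "\<dots> \<le> ?h (\<lambda>i. 1/2 * z i + (1 - 1/2) * 0)"
      by (rule log_concave_funD[OF gauss_iter_log_concave[OF lc iso of_nat_scale_pos]]) auto
    finally show ?thesis by (simp add: exp_minus field_simps)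
  qed
  have "(\<integral>\<^sup>+z. ennreal (sqrt (?h z)) \<partial>lebesgue_n n) \<le> (\<integral>\<^sup>+z. ennreal (exp (real n / 4)) * ennreal (?h (\<lambda>i. 0 + 1/2 * z i)) \<partial>lebesgue_n n)"
    using pt less_imp_le[OF gauss_iter_pos_nat] by (intro nn_integral_mono) (auto simp: ennreal_mult[symmetric])
  also have "\<dots> = ennreal (exp (real n / 4)) * (\<integral>\<^sup>+z. ennreal (?h (\<lambda>i. 0 + 1/2 * z i)) \<partial>lebesgue_n n)"
  proof (rule nn_integral_cmult)
    have "(\<lambda>x. ?h (\<lambda>i. 0 + 1/2 * x i)) \<in> borel_measurable (lebesgue_n n)"
      by (rule measurable_compose[OF measurable_compose[OF measurable_id_borel[OF refl] measurable_affine_coords]]) measurable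
    then show "(\<lambda>x. ennreal (?h (\<lambda>i. 0 + 1/2 * x i))) \<in> borel_measurable (lebesgue_n n)" by simp
  qed
  also have "(\<integral>\<^sup>+z. ennreal (?h (\<lambda>i. 0 + 1/2 * z i)) \<partial>lebesgue_n n) = ennreal (2 ^ n) * (\<integral>\<^sup>+z. ennreal (?h z) \<partial>lebesgue_n n)"
  proof -
    have "local_fun n (\<lambda>z. ennreal (?h z))"
      using gauss_iter_local[OF lc iso of_nat_scale_pos, of m] unfolding local_fun_def by metis
    then have "(\<integral>\<^sup>+z. ennreal (?h z) \<partial>lebesgue_n n) = ennreal ((1/2) ^ n) * (\<integral>\<^sup>+z. ennreal (?h (\<lambda>i. 0 + 1/2 * z i)) \<partial>lebesgue_n n)"
      by (subst nn_integral_lebesgue_n_affine[where c="1/2" and d="\<lambda>_. 0"]) auto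
    then have "ennreal (2 ^ n) * (\<integral>\<^sup>+z. ennreal (?h z) \<partial>lebesgue_n n) = ennreal (2 ^ n) * ennreal ((1/2) ^ n) * (\<integral>\<^sup>+z. ennreal (?h (\<lambda>i. 0 + 1/2 * z i)) \<partial>lebesgue_n n)"
      by (simp add: mult.assoc)
    also have "ennreal (2 ^ n) * ennreal ((1/2) ^ n) = 1"
      by (subst ennreal_mult[symmetric]) (auto simp: power_mult_distrib[symmetric])
    finally show ?thesis by simp
  qed
  also have "(\<integral>\<^sup>+z. ennreal (?h z) \<partial>lebesgue_n n) = ennreal (sqrt (2 * pi / m) ^ n)"
    by (rule gauss_iter_integral[OF lc iso of_nat_scale_pos])
  also have "ennreal (exp (real n / 4)) * (ennreal (2 ^ n) * ennreal (sqrt (2 * pi / m) ^ n)) = ennreal (2 ^ n * exp (real n / 4) * sqrt (2 * pi / m) ^ n)"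
    by (simp add: ennreal_mult[symmetric] mult.assoc mult.left_commute)
  finally show ?thesis .
qed

text \<open>The estimate is shown for each level \<open>r\<close> strictly above the value at
  \<open>x\<close>, where \<open>halfspace_below_level\<close> applies, and then \<open>r\<close>
  decreases to that value.\<close>

lemma tukey_depth_power_le:
  assumes x: "x \<in> Rn n"
  shows "tukey_depth n \<mu> x ^ m \<le> 2 * 2 ^ n * exp (real n / 4) * sqrt (gauss_iter n \<mu> m m x)"
proof -
  let ?h = "gauss_iter n \<mu> (real m) m" and ?\<phi> = "tukey_depth n \<mu> x"
  define V where "V = sqrt (2 * pi / m) ^ n"
  have V: "0 < V" using m by (simp add: V_def)
  have [measurable]: "?h \<in> borel_measurable borel"
    by (rule borel_measurable_continuous_onI[OF gauss_iter_cont_nat])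
  have le: "?\<phi> ^ m \<le> 2 * 2 ^ n * exp (real n / 4) * sqrt r" if r: "?h x < r" for r
  proof -
    have r0: "0 < r" using gauss_iter_pos_nat[of m x] r by simp
    obtain a where a: "\<exists>i<n. a i \<noteq> 0"
      "\<And>z. z \<in> Rn n \<Longrightarrow> (\<Sum>i<n. a i * x i) \<le> (\<Sum>i<n. a i * z i) \<Longrightarrow> ?h z < r"
      using halfspace_below_level[OF n gauss_iter_cont_nat gauss_iter_log_concave[OF lc iso of_nat_scale_pos] x r0 r] by blast
    define b where "b = (\<Sum>i<n. a i * x i)"
    define H where "H = {y \<in> Rn n. b \<le> (\<Sum>i<n. a i * y i)}"
    have H: "halfspace_n n H" "x \<in> H" using a(1) x by (auto simp: halfspace_n_def H_def b_def)
    have "ennreal (?\<phi> ^ m * V) \<le> ennreal (measure \<mu> H ^ m) * ennreal V"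
      using tukey_depth_le[OF H] tukey_depth_nonneg[OF n x] V
      by (auto simp: ennreal_mult[symmetric] intro!: ennreal_leI mult_right_mono power_mono)
    also have "\<dots> \<le> ennreal (measure \<mu> H ^ m) * (2 * halfspace_integral n (gauss n m) a 0)"
      unfolding V_def by (intro mult_left_mono halfspace_integral_gauss of_nat_scale_pos) auto
    \<comment> \<open>As many convolutions as the scale \<open>m\<close> bring the threshold
      \<open>b\<close> exactly to 0, where evenness of the Gaussian gives half of its mass.\<close>
    also have "\<dots> = 2 * (ennreal (measure \<mu> H ^ m) * halfspace_integral n (gauss n m) a (b - real m * (b / real m)))"
      using m by (simp add: mult.left_commute)
    also have "\<dots> \<le> 2 * halfspace_integral n ?h a b"
      unfolding H_def by (intro mult_left_mono halfspace_integral_gauss_iter_lower[OF lc iso of_nat_scale_pos]) auto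
    \<comment> \<open>On the half-space one of the two factors \<open>sqrt (h z)\<close> is at most
      \<open>sqrt r\<close>; the other stays in the integral.\<close>
    also have "halfspace_integral n ?h a b \<le> (\<integral>\<^sup>+z. ennreal (sqrt r) * ennreal (sqrt (?h z)) \<partial>lebesgue_n n)"
      unfolding halfspace_integral_def
    proof (rule nn_integral_mono)
      fix z assume "z \<in> space (lebesgue_n n)"
      then have z: "z \<in> Rn n" by (simp add: space_lebesgue_n)
      show "ennreal (?h z) * (if b \<le> (\<Sum>i<n. a i * z i) then 1 else 0) \<le> ennreal (sqrt r) * ennreal (sqrt (?h z))"
      proof (cases "b \<le> (\<Sum>i<n. a i * z i)")
        case True
        then have "?h z < r" using a(2)[OF z] by (simp add: b_def)
        then have "sqrt (?h z) * sqrt (?h z) \<le> sqrt r * sqrt (?h z)"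
          using gauss_iter_pos_nat[of m z] by (intro mult_right_mono) auto
        then show ?thesis using True gauss_iter_pos_nat[of m z] r0 by (simp add: ennreal_mult[symmetric] less_imp_le)
      qed auto
    qed
    also have "\<dots> = ennreal (sqrt r) * (\<integral>\<^sup>+z. ennreal (sqrt (?h z)) \<partial>lebesgue_n n)"
    proof (rule nn_integral_cmult)
      have "?h \<in> borel_measurable (lebesgue_n n)"
        by (rule measurable_compose[OF measurable_id_borel[OF refl]]) measurable
      then show "(\<lambda>x. ennreal (sqrt (?h x))) \<in> borel_measurable (lebesgue_n n)" by simp
    qed
    also have "\<dots> \<le> ennreal (sqrt r) * ennreal (2 ^ n * exp (real n / 4) * V)"
      unfolding V_def by (intro mult_left_mono gauss_iter_sqrt_integral) auto
    also have "2 * \<dots> = ennreal ((2 * 2 ^ n * exp (real n / 4) * sqrt r) * V)"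
      using V r0 by (simp add: ennreal_mult[symmetric] ennreal_numeral[symmetric] mult.assoc mult.left_commute del: ennreal_numeral)
    finally have "ennreal (?\<phi> ^ m * V) \<le> ennreal ((2 * 2 ^ n * exp (real n / 4) * sqrt r) * V)"
      by (simp add: mult_left_mono)
    then have "?\<phi> ^ m * V \<le> (2 * 2 ^ n * exp (real n / 4) * sqrt r) * V"
      using V r0 by (subst (asm) ennreal_le_iff) auto
    then show ?thesis using V by simp
  qed
  have "((\<lambda>r. 2 * 2 ^ n * exp (real n / 4) * sqrt r) \<longlongrightarrow> 2 * 2 ^ n * exp (real n / 4) * sqrt (?h x)) (at_right (?h x))"
    by (intro tendsto_intros)
  then show ?thesis
    by (rule tendsto_lowerbound) (auto simp: eventually_at_right_less intro: le eventually_mono[OF eventually_at_right_less])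
qed

end

section \<open>The expected depth\<close>

text \<open>If \<open>\<nu>\<close> has no density then \<^const>\<open>RN_deriv\<close> is the zero function, and an unbounded density has
  \<^const>\<open>enn2real\<close> of its essential supremum equal to \<open>0\<close>. So a nonzero isotropic constant
  guarantees a bounded density; for a zero constant the bound of the theorem is \<open>exp 0\<close>, since \<open>x / 0 = 0\<close>.\<close>

lemma nn_integral_le_isotropic_constant:
  fixes g :: "(nat \<Rightarrow> real) \<Rightarrow> ennreal"
  assumes n: "0 < n" and L: "isotropic_constant n \<nu> \<noteq> 0" and g: "g \<in> borel_measurable (lebesgue_n n)"
  shows "(\<integral>\<^sup>+x. g x \<partial>\<nu>) \<le> ennreal (isotropic_constant n \<nu> ^ n) * (\<integral>\<^sup>+x. g x \<partial>lebesgue_n n)"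
proof -
  let ?L = "lebesgue_n n"
  let ?f = "RN_deriv ?L \<nu>"
  define M where "M = esssup ?L ?f"
  have pos: "enn2real M \<noteq> 0" using L by (auto simp: isotropic_constant_def M_def)
  have pow: "isotropic_constant n \<nu> ^ n = enn2real M"
  proof -
    have "0 < enn2real M" using pos enn2real_nonneg[of M] by linarith
    then have "(enn2real M powr (1 / real n)) ^ n = enn2real M"
      using n by (simp add: powr_realpow[symmetric] powr_powr)
    then show ?thesis by (simp add: isotropic_constant_def M_def)
  qed
  have "M \<noteq> top" using pos by auto
  then have M: "ennreal (enn2real M) = M" by (simp add: less_top[symmetric])
  have "\<exists>f. f \<in> borel_measurable ?L \<and> density ?L f = \<nu>"
  proof (rule ccontr)
    assume "\<not> ?thesis"
    then have "?f = (\<lambda>_. 0)" unfolding RN_deriv_def by (rule if_not_P)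
    then have "M \<le> 0" unfolding M_def by (intro esssup_I) auto
    then show False using pos by simp
  qed
  then have dens: "density ?L ?f = \<nu>" using RN_derivI by blast
  have "(\<integral>\<^sup>+x. g x \<partial>\<nu>) = (\<integral>\<^sup>+x. ?f x * g x \<partial>?L)"
    by (subst dens[symmetric], subst nn_integral_density) (auto simp: g)
  also have "\<dots> \<le> (\<integral>\<^sup>+x. M * g x \<partial>?L)"
  proof (rule nn_integral_mono_AE)
    show "AE x in ?L. ?f x * g x \<le> M * g x"
      using esssup_AE[of ?f ?L] by eventually_elim (simp add: M_def mult_right_mono)
  qed
  also have "\<dots> = M * (\<integral>\<^sup>+x. g x \<partial>?L)" by (rule nn_integral_cmult[OF g])
  finally show ?thesis using M pow by simp
qed

text \<open>Test \<open>\<nu>\<close> against the standard Gaussian: Jensen bounds the expectation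
  below by \<open>exp (- n / 2)\<close>, the density bound above by
  \<open>(L * sqrt (2 * pi)) ^ n\<close>. This is used to round a multiple of
  \<open>L\<^sup>2\<close> up to an integer at the cost of a factor 2.\<close>

lemma isotropic_constant_lower:
  assumes n: "0 < n" and \<nu>: "log_concave_prob n \<nu>" "isotropic n \<nu>" and L: "isotropic_constant n \<nu> \<noteq> 0"
  shows "1 \<le> 2 * pi * exp 1 * (isotropic_constant n \<nu>)\<^sup>2"
proof -
  let ?L = "isotropic_constant n \<nu>"
  have L0: "0 \<le> ?L" by (simp add: isotropic_constant_def)
  note ps = \<nu>(1)[unfolded log_concave_prob_def, THEN conjunct1] \<nu>(1)[unfolded log_concave_prob_def, THEN conjunct2, THEN conjunct1]
  have "exp (- (real n / 2)) \<le> smooth \<nu> 1 (gauss n 1) (\<lambda>_. 0)"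
    using smooth_gauss_lower[OF ps \<nu>(2) continuous_on_gauss, where s=1 and k=0 and c=1 and x="\<lambda>_. 0", of n 1]
    by (simp add: gauss_le_1 less_imp_le[OF gauss_pos]) (simp add: gauss_def)
  also have "\<dots> = (\<integral>y. gauss n 1 y \<partial>\<nu>)" by (simp add: smooth_def gauss_def)
  finally have "ennreal (exp (- (real n / 2))) \<le> ennreal (\<integral>y. gauss n 1 y \<partial>\<nu>)" by (rule ennreal_leI)
  also have "\<dots> = (\<integral>\<^sup>+y. ennreal (gauss n 1 y) \<partial>\<nu>)"
    using integrable_shift[OF ps continuous_on_gauss, where x="\<lambda>_. 0" and c="-1", of n 1]
    by (intro nn_integral_eq_integral[symmetric]) (auto simp: gauss_le_1 less_imp_le[OF gauss_pos])
  also have "\<dots> \<le> ennreal (?L ^ n) * (\<integral>\<^sup>+y. ennreal (gauss n 1 y) \<partial>lebesgue_n n)"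
  proof (rule nn_integral_le_isotropic_constant[OF n L])
    have "gauss n 1 \<in> borel_measurable (lebesgue_n n)"
      using measurable_compose[OF measurable_id_borel[OF refl] borel_measurable_continuous_onI[OF continuous_on_gauss]] .
    then show "(\<lambda>y. ennreal (gauss n 1 y)) \<in> borel_measurable (lebesgue_n n)" by simp
  qed
  also have "\<dots> = ennreal ((?L * sqrt (2 * pi)) ^ n)"
    using nn_integral_gaussian[of 1 n] L0 by (simp add: gauss_def ennreal_mult[symmetric] power_mult_distrib)
  finally have "exp (- (real n / 2)) \<le> (?L * sqrt (2 * pi)) ^ n"
    using L0 by (subst (asm) ennreal_le_iff) auto
  moreover have "exp (- (real n / 2)) = exp (- 1 / 2) ^ n"
    using exp_of_nat_mult[of n "- 1 / 2 :: real"] by simp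
  ultimately have "exp (- 1 / 2) \<le> ?L * sqrt (2 * pi)"
    using power_le_imp_le_base[of "exp (- 1 / 2)" "n - 1" "?L * sqrt (2 * pi)"] L0 n by simp
  then have "(exp (- 1 / 2))\<^sup>2 \<le> (?L * sqrt (2 * pi))\<^sup>2"
    by (intro power_mono) auto
  then show ?thesis
    by (simp add: power_mult_distrib power2_eq_square[of "exp _"] exp_add[symmetric] exp_minus field_simps)
qed

text \<open>The \<open>m\<close>-th power of the depth is at most \<open>\<psi>\<close>, whose mean
  under \<open>\<nu>\<close> is at most \<open>exp (- n)\<close>. A tangent line of the
  \<open>m\<close>-th power carries this over to the first moment; the comparison is pointwise, so
  only the majorant built from \<open>\<psi>\<close> has to be measurable.\<close>

lemma expectation_tukey_depth_le:
  assumes n: "0 < n" and m: "0 < m"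
    and \<mu>: "log_concave_prob n \<mu>" "isotropic n \<mu>" and \<nu>: "log_concave_prob n \<nu>" and L: "isotropic_constant n \<nu> \<noteq> 0"
    and big: "128 * pi * exp 3 * (isotropic_constant n \<nu>)\<^sup>2 \<le> real m"
  shows "(\<integral>\<^sup>+x. ennreal (tukey_depth n \<mu> x) \<partial>\<nu>) \<le> ennreal (exp (- real n / real m))"
proof -
  let ?L = "isotropic_constant n \<nu>" and ?\<phi> = "tukey_depth n \<mu>"
  have L0: "0 \<le> ?L" by (simp add: isotropic_constant_def)
  interpret \<nu>: prob_space \<nu> using \<nu> by (simp add: log_concave_prob_def)
  have sets: "sets \<nu> = sets (lebesgue_n n)" using \<nu> by (simp add: log_concave_prob_def)
  have sp: "space \<nu> = Rn n" using sets_eq_imp_space_eq[OF sets] by (simp add: space_lebesgue_n)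
  define \<psi> where "\<psi> x = 2 * 2 ^ n * exp (real n / 4) * sqrt (gauss_iter n \<mu> m m x)" for x
  have \<psi>0: "0 \<le> \<psi> x" for x
    unfolding \<psi>_def using gauss_iter_pos[OF \<mu>, of "real m" m x] m by (intro mult_nonneg_nonneg) auto
  have hb: "gauss_iter n \<mu> m m \<in> borel_measurable borel"
    using m by (intro borel_measurable_continuous_onI gauss_iter_cont[OF \<mu>]) auto
  have hm[measurable]: "gauss_iter n \<mu> m m \<in> borel_measurable (lebesgue_n n)"
    by (rule measurable_compose[OF measurable_id_borel[OF refl] hb])
  have \<psi>_meas[measurable]: "\<psi> \<in> borel_measurable (lebesgue_n n)"
    unfolding \<psi>_def[abs_def] by measurable
  have \<psi>_meas'[measurable]: "\<psi> \<in> borel_measurable \<nu>"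
    using \<psi>_meas sets by (simp cong: measurable_cong_sets)
  have "(\<integral>\<^sup>+x. ennreal (\<psi> x) \<partial>\<nu>) \<le> ennreal (?L ^ n) * (\<integral>\<^sup>+x. ennreal (\<psi> x) \<partial>lebesgue_n n)"
    by (intro nn_integral_le_isotropic_constant[OF n L]) measurable
  also have "(\<integral>\<^sup>+x. ennreal (\<psi> x) \<partial>lebesgue_n n)
      = ennreal (2 * 2 ^ n * exp (real n / 4)) * (\<integral>\<^sup>+x. ennreal (sqrt (gauss_iter n \<mu> m m x)) \<partial>lebesgue_n n)"
    unfolding \<psi>_def by (subst ennreal_mult', simp, subst nn_integral_cmult) auto
  also have "\<dots> \<le> ennreal (2 * 2 ^ n * exp (real n / 4)) * ennreal (2 ^ n * exp (real n / 4) * sqrt (2 * pi / m) ^ n)"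
    by (intro mult_left_mono gauss_iter_sqrt_integral[OF \<mu> n m]) auto
  also have "ennreal (?L ^ n) * \<dots> = ennreal (2 * (4 * exp (1/2) * (sqrt (2 * pi / m) * ?L)) ^ n)"
  proof -
    have "exp (real n / 4) * exp (real n / 4) = exp (1/2) ^ n"
      using exp_of_nat_mult[of n "1/2 :: real"] by (simp add: exp_add[symmetric])
    moreover have "(2::real) ^ n * 2 ^ n = 4 ^ n" by (simp add: power_mult_distrib[symmetric])
    moreover have "?L ^ n * (2 * 2 ^ n * exp (real n / 4) * (2 ^ n * exp (real n / 4) * sqrt (2 * pi / m) ^ n))
      = 2 * ((2 ^ n * 2 ^ n) * (exp (real n / 4) * exp (real n / 4)) * (sqrt (2 * pi / m) ^ n * ?L ^ n))"
      by (simp only: mult_ac)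
    ultimately have "?L ^ n * (2 * 2 ^ n * exp (real n / 4) * (2 ^ n * exp (real n / 4) * sqrt (2 * pi / m) ^ n))
      = 2 * (4 * exp (1/2) * (sqrt (2 * pi / m) * ?L)) ^ n"
      by (simp only: power_mult_distrib)
    then show ?thesis using L0 by (simp add: ennreal_mult[symmetric])
  qed
  also have "\<dots> \<le> ennreal (exp (- real n))"
  proof (rule ennreal_leI)
    \<comment> \<open>The constant in \<open>big\<close> is chosen for this: it makes the base of
      the \<open>n\<close>-th power at most \<open>exp (- 1) / 2\<close>.\<close>
    have "sqrt (2 * pi / m) * ?L \<le> exp (- 3 / 2) / 8"
    proof (rule power2_le_imp_le)
      have "(sqrt (2 * pi / m) * ?L)\<^sup>2 = 2 * pi * ?L\<^sup>2 / m" by (simp add: power_mult_distrib)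
      also have "\<dots> \<le> exp (- 3) / 64"
        using big m by (simp add: exp_minus field_simps)
      also have "\<dots> = (exp (- 3 / 2) / 8)\<^sup>2"
        by (simp add: power_divide power2_eq_square exp_add[symmetric])
      finally show "(sqrt (2 * pi / m) * ?L)\<^sup>2 \<le> (exp (- 3 / 2) / 8)\<^sup>2" .
    qed auto
    then have "4 * exp (1/2) * (sqrt (2 * pi / m) * ?L) \<le> 4 * exp (1/2) * (exp (- 3 / 2) / 8)"
      by (intro mult_left_mono) auto
    also have "\<dots> = exp (- 1) / 2" by (simp add: exp_add[symmetric])
    finally have "(4 * exp (1/2) * (sqrt (2 * pi / m) * ?L)) ^ n \<le> (exp (- 1) / 2) ^ n"
      using L0 by (intro power_mono) auto
    also have "\<dots> = exp (- real n) / 2 ^ n"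
      using exp_of_nat_mult[of n "- 1 :: real"] by (simp add: power_divide)
    \<comment> \<open>Since \<open>n\<close> is at least 1, the spare factor
      \<open>1 / 2 ^ n\<close> absorbs the leading 2.\<close>
    also have "\<dots> \<le> exp (- real n) / 2"
      using n self_le_power[of "2::real" n] by (intro divide_left_mono) auto
    finally show "2 * (4 * exp (1/2) * (sqrt (2 * pi / m) * ?L)) ^ n \<le> exp (- real n)" by simp
  qed
  finally have \<psi>_int: "(\<integral>\<^sup>+x. ennreal (\<psi> x) \<partial>\<nu>) \<le> ennreal (exp (- real n))"
    by (simp add: mult_left_mono)
  define l where "l = exp (- real n / real m)"
  have l: "0 < l" "l ^ m = exp (- real n)"
    using m exp_of_nat_mult[of m "- real n / real m"] by (simp_all add: l_def)
  \<comment> \<open>Tangent line of the \<open>m\<close>-th power at \<open>l\<close>, solved for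
    the base: \<open>t \<le> a + b * t ^ m\<close> for \<open>t \<ge> 0\<close>, with equality at
    \<open>t = l\<close>. It follows from Bernoulli's inequality for \<open>t / l\<close>.\<close>
  define a b where "a = (real m - 1) / m * l" and "b = l / (m * l ^ m)"
  have ab: "0 \<le> a" "0 \<le> b" using l(1) m by (auto simp: a_def b_def)
  have "(\<integral>\<^sup>+x. ennreal (?\<phi> x) \<partial>\<nu>) \<le> (\<integral>\<^sup>+x. ennreal a + ennreal b * ennreal (\<psi> x) \<partial>\<nu>)"
  proof (rule nn_integral_mono)
    fix x assume "x \<in> space \<nu>"
    then have x: "x \<in> Rn n" by (simp add: sp)
    have \<phi>0: "0 \<le> ?\<phi> x" by (rule tukey_depth_nonneg[OF n x])
    have "1 + real m * (?\<phi> x / l - 1) \<le> (1 + (?\<phi> x / l - 1)) ^ m"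
      using \<phi>0 l by (intro Bernoulli_inequality) auto
    also have "\<dots> = ?\<phi> x ^ m / l ^ m" by (simp add: power_divide)
    also have "\<dots> \<le> \<psi> x / l ^ m"
      using tukey_depth_power_le[OF \<mu> n m x] l(1) by (intro divide_right_mono) (auto simp: \<psi>_def)
    finally have "l / m * (1 + real m * (?\<phi> x / l - 1)) \<le> l / m * (\<psi> x / l ^ m)"
      using l(1) by (intro mult_left_mono) auto
    moreover have "l / m * (1 + real m * (?\<phi> x / l - 1)) = ?\<phi> x - a"
      using l(1) m by (simp add: a_def field_simps)
    moreover have "l / m * (\<psi> x / l ^ m) = b * \<psi> x" by (simp add: b_def)
    ultimately have "?\<phi> x \<le> a + b * \<psi> x" by linarith
    then have "ennreal (?\<phi> x) \<le> ennreal (a + b * \<psi> x)" by (rule ennreal_leI)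
    also have "\<dots> = ennreal a + ennreal b * ennreal (\<psi> x)"
      using ab \<psi>0[of x] by (subst ennreal_plus) (auto simp: ennreal_mult)
    finally show "ennreal (?\<phi> x) \<le> ennreal a + ennreal b * ennreal (\<psi> x)" .
  qed
  also have "\<dots> = ennreal a + ennreal b * (\<integral>\<^sup>+x. ennreal (\<psi> x) \<partial>\<nu>)"
    using \<nu>.emeasure_space_1 by (subst nn_integral_add) (auto simp: nn_integral_cmult)
  also have "\<dots> \<le> ennreal a + ennreal b * ennreal (exp (- real n))"
    by (intro add_left_mono mult_left_mono \<psi>_int) auto
  also have "\<dots> = ennreal (a + b * exp (- real n))"
    using ab by (subst ennreal_plus) (auto simp: ennreal_mult)
  also have "a + b * exp (- real n) = l"
    using l(1) m unfolding l(2)[symmetric] a_def b_def by (simp add: field_simps)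
  finally show ?thesis by (simp add: l_def)
qed

theorem theorem1p2:
  shows "\<exists>c::real. c > 0 \<and> (\<exists>n0::nat. \<forall>n\<ge>n0. \<forall>\<mu> \<nu>.
     log_concave_prob n \<mu> \<and> isotropic n \<mu> \<and> log_concave_prob n \<nu> \<and> isotropic n \<nu> \<longrightarrow>
     (\<integral>\<^sup>+ x. ennreal (tukey_depth n \<mu> x) \<partial>\<nu>)
       \<le> ennreal (exp (- c * real n / (isotropic_constant n \<nu>)\<^sup>2)))"
\<comment> \<open>The constant is half of \<open>1 / (128 * pi * exp 3)\<close>; the half pays for
  rounding the exponent up to an integer.\<close>
proof (intro exI[of _ "1 / (256 * pi * exp 3)"] conjI exI[of _ "1::nat"] allI impI)
  fix n :: nat and \<mu> \<nu> :: "(nat \<Rightarrow> real) measure"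
  assume "1 \<le> n" and "log_concave_prob n \<mu> \<and> isotropic n \<mu> \<and> log_concave_prob n \<nu> \<and> isotropic n \<nu>"
  then have n: "0 < n" and \<mu>: "log_concave_prob n \<mu>" "isotropic n \<mu>" and \<nu>: "log_concave_prob n \<nu>" "isotropic n \<nu>"
    by auto
  interpret \<nu>: prob_space \<nu> using \<nu> by (simp add: log_concave_prob_def)
  have sp: "space \<nu> = Rn n"
    using sets_eq_imp_space_eq[of \<nu> "lebesgue_n n"] \<nu>(1) by (simp add: space_lebesgue_n log_concave_prob_def)
  let ?L = "isotropic_constant n \<nu>" and ?c = "1 / (256 * pi * exp 3) :: real"
  show "(\<integral>\<^sup>+ x. ennreal (tukey_depth n \<mu> x) \<partial>\<nu>) \<le> ennreal (exp (- ?c * real n / ?L\<^sup>2))"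
  proof (cases "?L = 0")
    case True
    \<comment> \<open>Here the right-hand side is 1, and the depth never exceeds 1.\<close>
    have "(\<integral>\<^sup>+ x. ennreal (tukey_depth n \<mu> x) \<partial>\<nu>) \<le> (\<integral>\<^sup>+ x. 1 \<partial>\<nu>)"
      using tukey_depth_le_1[OF _ n] \<mu>(1) by (intro nn_integral_mono) (auto simp: sp log_concave_prob_def)
    then show ?thesis using True \<nu>.emeasure_space_1 by simp
  next
    case False
    define A where "A = 128 * pi * exp 3 * ?L\<^sup>2"
    define m where "m = nat \<lceil>A\<rceil>"
    have "1 \<le> 2 * pi * exp 1 * ?L\<^sup>2" by (rule isotropic_constant_lower[OF n \<nu> False])
    also have "\<dots> \<le> 128 * pi * exp 3 * ?L\<^sup>2"
      by (intro mult_right_mono mult_mono) auto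
    finally have A1: "1 \<le> A" by (simp add: A_def)
    \<comment> \<open>From \<open>A \<ge> 1\<close>, the ceiling is below \<open>A + 1\<close> and
      so at most \<open>2 * A\<close>.\<close>
    have m: "0 < m" "A \<le> real m" "real m \<le> 2 * A"
      using A1 unfolding m_def by linarith+
    have "(\<integral>\<^sup>+ x. ennreal (tukey_depth n \<mu> x) \<partial>\<nu>) \<le> ennreal (exp (- real n / real m))"
      by (rule expectation_tukey_depth_le[OF n m(1) \<mu> \<nu>(1) False]) (use m(2) in \<open>simp add: A_def\<close>)
    also have "\<dots> \<le> ennreal (exp (- ?c * real n / ?L\<^sup>2))"
    proof (intro ennreal_leI)
      have "real n / (2 * A) \<le> real n / real m"
        using m by (intro divide_left_mono) auto
      then show "exp (- real n / real m) \<le> exp (- ?c * real n / ?L\<^sup>2)"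
        by (simp add: A_def)
    qed
    finally show ?thesis .
  qed
qed simp

end
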